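(* With the labelling $a_i,b_i,c_{ij}$ of the $27$ roots of $U'$ described in the context, the residue sets of the triples in $\Omega_{U'}$ are: (i) If $1\le i<j\le 6$, then $a_ic_{ij}b_j$ has level $5+i-j$ and $\mathrm{Res}_{U'}(a_ic_{ij}b_j)=\{a_h:1\le h<i\}\cup\{c_{ik}:j<k\le6\}$. (ii) If $1\le j<i\le 6$, then $a_ic_{ij}b_j$ has level $4+i-j$ and $\mathrm{Res}_{U'}(a_ic_{ij}b_j)=\{a_h:1\le h<i\}\cup\{c_{ki}:j<k\le 6,\ k\ne i\}$. (iii) If $M=\{\{i_1,j_1\},\{i_2,j_2\},\{i_3,j_3\}\}$ is a perfect matching of $\{1,\dots,6\}$ and $\tau=(i_1,j_1)(i_2,j_2)(i_3,j_3)$ is the associated fixed point free involution, then $c_{i_1j_1}c_{i_2j_2}c_{i_3j_3}$ has level $(\ell(\tau)+9)/2$, where $\ell$ is Coxeter length in $S_6$, and $\mathrm{Res}_{U'}(c_{i_1j_1}c_{i_2j_2}c_{i_3j_3})=\{a_i:1\le i\le6\}\cup\{c_{pq}:\tau(p)<q\text{ and }\tau(q)<p\}$.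
   Context: $\Phi$ is the root system of type $E_8$ with simple roots $\alpha_1,\dots,\alpha_8$ labelled so that $\alpha_1,\alpha_3,\alpha_4,\alpha_5,\alpha_6,\alpha_7,\alpha_8$ form a path in this order and $\alpha_2$ is joined only to $\alpha_4$; $B$ is the invariant form ($B(\alpha_i,\alpha_i)=2$, $-1$ for adjacent nodes, $0$ otherwise), $s_\alpha(\beta)=\beta-B(\alpha,\beta)\alpha$, $s_8=s_{\alpha_8}$. The $i$-height of a root is its $\alpha_i$-coefficient. $U'$ is the set of positive roots of $8$-height $0$ and $7$-height $1$ (27 roots). For $U\subseteq\Phi_+$, $\Omega_U$ is the set of pairwise orthogonal subsets of $U$ of maximal size (for $U'$ these are triples, written as products of their elements, e.g. $a_ic_{ij}b_j=\{a_i,c_{ij},b_j\}$); $\mathrm{Res}_U(R)=\{\gamma\in U:s_\beta(\gamma)\in\Phi_+\ \forall\beta\in R\}$, and the level of $R$ is $|\mathrm{Res}_{U}(R)|$. Labelling: for $\gamma\in U'$ write $s_8(\gamma)=\gamma+\alpha_8=\alpha_8+\sum_{i=1}^7 d_i\alpha_i$ and set $f(\gamma)=(-1,-1,-1,-1,-1,-1,3,3)+d_1\alpha'_1+d_3\alpha'_2+d_4\alpha'_3+d_5\alpha'_4+d_6\alpha'_5+d_7\alpha'_6+d_2\alpha'_7\in\mathbb R^8$, where $\alpha'_i=4(\varepsilon_i-\varepsilon_{i+1})$ for $1\le i\le6$ and $\alpha'_7=(-2,-2,-2,2,2,2,2,-2)$. Put $v_{ij}=4(\varepsilon_i+\varepsilon_j)-\sum_{k=1}^8\varepsilon_k$.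 Then $a_i$ ($1\le i\le6$) denotes the $\gamma\in U'$ with $f(\gamma)=v_{i7}$, $b_i$ the one with $f(\gamma)=v_{i8}$, and $c_{ij}=c_{ji}$ ($1\le i\ne j\le6$) the one with $f(\gamma)=-v_{ij}$; this gives $U'=\{a_i\}\sqcup\{b_i\}\sqcup\{c_{ij}\}$, and the elements of $\Omega_{U'}$ are exactly the triples $a_ic_{ij}b_j$ ($i\ne j$) and $c_{i_1j_1}c_{i_2j_2}c_{i_3j_3}$ for perfect matchings $\{\{i_1,j_1\},\{i_2,j_2\},\{i_3,j_3\}\}$ of $\{1,\dots,6\}$. *)

theory Defs
  imports "HOL-Analysis.Analysis" "HOL-Combinatorics.Transposition"
begin

text \<open>Vectors of the reflection representation are given by their coordinates with respect to
  the simple roots. The nodes of the Dynkin diagram are the elements of the numeral type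
  \<^typ>\<open>8\<close>; the node 8 is the element \<open>8 = 0\<close> of that type.\<close>

definition simple_root :: "8 \<Rightarrow> real^8" where
  "simple_root i = axis i 1"

definition e8_edges :: "8 set set" where
  "e8_edges = {{1,3}, {3,4}, {4,5}, {5,6}, {6,7}, {7,8}, {2,4}}"

definition cartan :: "8 \<Rightarrow> 8 \<Rightarrow> real" where
  "cartan i j = (if i = j then 2 else if {i,j} \<in> e8_edges then -1 else 0)"

definition B :: "real^8 \<Rightarrow> real^8 \<Rightarrow> real" where
  "B x y = (\<Sum>i\<in>UNIV. \<Sum>j\<in>UNIV. (x $ i) * cartan i j * (y $ j))"

definition refl_root :: "real^8 \<Rightarrow> real^8 \<Rightarrow> real^8" where
  "refl_root \<alpha> \<beta> = \<beta> - B \<alpha> \<beta> *\<^sub>R \<alpha>"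

text \<open>The root system is the orbit of the simple roots under the Weyl group, which is generated
  by the simple reflections.\<close>

inductive_set Phi :: "(real^8) set" where
  simple: "simple_root i \<in> Phi"
| reflect: "\<beta> \<in> Phi \<Longrightarrow> refl_root (simple_root i) \<beta> \<in> Phi"

definition Phi_pos :: "(real^8) set" where
  "Phi_pos = {\<gamma> \<in> Phi. \<forall>i. 0 \<le> \<gamma> $ i}"

definition height_at :: "8 \<Rightarrow> real^8 \<Rightarrow> real" where
  "height_at i \<gamma> = \<gamma> $ i"

definition U' :: "(real^8) set" where
  "U' = {\<gamma> \<in> Phi_pos. height_at 8 \<gamma> = 0 \<and> height_at 7 \<gamma> = 1}"

definition Omega :: "(real^8) set \<Rightarrow> (real^8) set set" where
  "Omega U = {R. is_arg_max card (\<lambda>S. S \<subseteq> U \<and> pairwise (\<lambda>\<beta> \<gamma>. B \<beta> \<gamma> = 0) S) R}"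

definition Res :: "(real^8) set \<Rightarrow> (real^8) set \<Rightarrow> (real^8) set" where
  "Res U R = {\<gamma> \<in> U. \<forall>\<beta>\<in>R. refl_root \<beta> \<gamma> \<in> Phi_pos}"

definition level :: "(real^8) set \<Rightarrow> (real^8) set \<Rightarrow> nat" where
  "level U R = card (Res U R)"


text \<open>In the labelling, \<^typ>\<open>real^8\<close> is the second copy of Euclidean 8-space, with standard
  basis \<open>\<epsilon>\<^sub>1, \<dots>, \<epsilon>\<^sub>8\<close>. The labels themselves are natural numbers, because their linear order
  and arithmetic matter.\<close>

definition eps :: "nat \<Rightarrow> real^8" where
  "eps i = axis (of_nat i) 1"

definition alpha' :: "nat \<Rightarrow> real^8" where
  "alpha' i = (if i = 7 then vector [-2,-2,-2,2,2,2,2,-2] else 4 *\<^sub>R (eps i - eps (i + 1)))"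

definition f :: "real^8 \<Rightarrow> real^8" where
  "f \<gamma> = (let d = (\<lambda>i. refl_root (simple_root 8) \<gamma> $ i) in
     vector [-1,-1,-1,-1,-1,-1,3,3]
     + d 1 *\<^sub>R alpha' 1 + d 3 *\<^sub>R alpha' 2 + d 4 *\<^sub>R alpha' 3 + d 5 *\<^sub>R alpha' 4
     + d 6 *\<^sub>R alpha' 5 + d 7 *\<^sub>R alpha' 6 + d 2 *\<^sub>R alpha' 7)"

definition v :: "nat \<Rightarrow> nat \<Rightarrow> real^8" where
  "v i j = 4 *\<^sub>R (eps i + eps j) - (\<Sum>k = 1..8. eps k)"

definition root_a :: "nat \<Rightarrow> real^8" where
  "root_a i = (THE \<gamma>. \<gamma> \<in> U' \<and> f \<gamma> = v i 7)"

definition root_b :: "nat \<Rightarrow> real^8" where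
  "root_b i = (THE \<gamma>. \<gamma> \<in> U' \<and> f \<gamma> = v i 8)"

definition root_c :: "nat \<Rightarrow> nat \<Rightarrow> real^8" where
  "root_c i j = (THE \<gamma>. \<gamma> \<in> U' \<and> f \<gamma> = - v i j)"


definition perfect_matching :: "'a set \<Rightarrow> 'a set set \<Rightarrow> bool" where
  "perfect_matching V M \<longleftrightarrow> partition_on V M \<and> (\<forall>e\<in>M. card e = 2)"

text \<open>Length of a permutation \<open>w\<close> of \<open>{1..n}\<close> with respect to the Coxeter generators
  \<open>(k, k+1)\<close>, \<open>1 \<le> k < n\<close>, of the symmetric group.\<close>

definition coxeter_length :: "nat \<Rightarrow> (nat \<Rightarrow> nat) \<Rightarrow> nat" where
  "coxeter_length n w = (LEAST l. \<exists>ks. length ks = l \<and> set ks \<subseteq> {1..<n} \<and>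
     w = foldr (\<lambda>k u. Transposition.transpose k (k + 1) \<circ> u) ks id)"

end

theory Submission
  imports Defs "HOL-Combinatorics.Permutations"
begin

text \<open>
  The map \<open>f\<close> is affine and injective on the vectors with \<open>7\<close>-height \<open>1\<close> and \<open>8\<close>-height \<open>0\<close>, and
  there \<open>16 B(\<beta>, \<gamma>) = f \<beta> \<bullet> f \<gamma> + 8\<close>. Hence the labels \<open>\<plusminus> v\<^sub>i\<^sub>j\<close> determine all inner
  products of the roots in \<open>U'\<close>, which are \<open>0\<close>, \<open>1\<close> or \<open>2\<close>. If \<open>B(\<beta>, \<gamma>) = 0\<close>, then \<open>s\<^sub>\<beta>\<close> fixes \<open>\<gamma>\<close>; if
  \<open>B(\<beta>, \<gamma>) = 1\<close>, then \<open>s\<^sub>\<beta> \<gamma> = \<gamma> - \<beta>\<close> is positive exactly when \<open>\<beta> \<le> \<gamma>\<close> coefficientwise. This order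
  is read off from explicit coefficients, and gives the residue sets. An orthogonal subset of
  \<open>U'\<close> that contains only roots \<open>c\<^sub>i\<^sub>j\<close> is a partial matching of \<open>{1..6}\<close>, which extends to a perfect one.
  For a fixed point free involution \<open>\<tau>\<close> of \<open>{1..n}\<close> the map \<open>(x, y) \<mapsto> (\<tau> x, y)\<close> takes the inversions
  of \<open>\<tau>\<close> to the pairs \<open>(p, q)\<close> with \<open>\<tau> p < q\<close> and \<open>\<tau> q < p\<close>; \<open>n / 2\<close> of these have \<open>p = q\<close>, and the others
  come in pairs \<open>(p, q)\<close>, \<open>(q, p)\<close>. This counts the roots \<open>c\<^sub>p\<^sub>q\<close> in a residue set in terms of the
  Coxeter length of \<open>\<tau>\<close>.
\<close>

section \<open>The root system in coordinates\<close>

text \<open>The eight numerals are distinct residues modulo 8, the last being 0, so counting shows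
  that nothing is left out.\<close>

lemma UNIV_8: "(UNIV :: 8 set) = {1,2,3,4,5,6,7,8}"
proof -
  have "card {1,2,3,4,5,6,7,8::8} = CARD(8)"
    by simp
  then show ?thesis
    by (metis card_subset_eq finite_code subset_UNIV)
qed

lemma forall_8: "(\<forall>i::8. P i) \<longleftrightarrow> P 1 \<and> P 2 \<and> P 3 \<and> P 4 \<and> P 5 \<and> P 6 \<and> P 7 \<and> P 8"
  by (metis UNIV_8 UNIV_I insertE singletonD)

lemma sum_8: "sum g (UNIV :: 8 set) = g 1 + g 2 + g 3 + g 4 + g 5 + g 6 + g 7 + g 8"
  unfolding UNIV_8 by (simp add: add.assoc)

lemma vector_8 [simp]:
  fixes x1 x2 x3 x4 x5 x6 x7 x8 :: "'a::zero"
  defines "w \<equiv> vector [x1,x2,x3,x4,x5,x6,x7,x8] :: 'a^8"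
  shows "w $ 1 = x1" "w $ 2 = x2" "w $ 3 = x3" "w $ 4 = x4"
    "w $ 5 = x5" "w $ 6 = x6" "w $ 7 = x7" "w $ 8 = x8"
  unfolding w_def vector_def by simp_all

section \<open>The invariant form and the reflections\<close>

lemma B_eq:
  "B x y = 2 * (x$1 * y$1 + x$2 * y$2 + x$3 * y$3 + x$4 * y$4 + x$5 * y$5 + x$6 * y$6
      + x$7 * y$7 + x$8 * y$8)
    - (x$1 * y$3 + x$3 * y$1 + x$3 * y$4 + x$4 * y$3 + x$4 * y$5 + x$5 * y$4 + x$5 * y$6 + x$6 * y$5
      + x$6 * y$7 + x$7 * y$6 + x$7 * y$8 + x$8 * y$7 + x$2 * y$4 + x$4 * y$2)"
  unfolding B_def sum_8 by (simp add: cartan_def e8_edges_def doubleton_eq_iff)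

lemma B_commute: "B x y = B y x"
  by (simp add: B_eq)

lemma B_diff_right: "B x (y - z) = B x y - B x z"
  by (simp add: B_eq algebra_simps)

lemma B_diff_left: "B (x - y) z = B x z - B y z"
  by (simp add: B_eq algebra_simps)

lemma B_scaleR_left: "B (c *\<^sub>R x) y = c * B x y"
  by (simp add: B_eq algebra_simps)

lemma B_scaleR_right: "B x (c *\<^sub>R y) = c * B x y"
  by (simp add: B_eq algebra_simps)

lemma B_refl_root:
  assumes "B \<alpha> \<alpha> = 2"
  shows "B (refl_root \<alpha> x) (refl_root \<alpha> y) = B x y"
  using assms B_commute[of x \<alpha>]
  by (simp add: refl_root_def B_diff_left B_diff_right B_scaleR_left B_scaleR_right)

lemma B_simple_root: "B (simple_root i) (simple_root i) = 2"
proof -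
  have "\<forall>i. B (simple_root i) (simple_root i) = 2"
    unfolding forall_8 by (simp add: B_eq simple_root_def axis_def)
  then show ?thesis by blast
qed

text \<open>Reflections in vectors of norm 2 preserve \<open>B\<close>, so the orbit keeps the norm
  of the simple roots.\<close>

lemma B_Phi: "\<gamma> \<in> Phi \<Longrightarrow> B \<gamma> \<gamma> = 2"
  by (induction rule: Phi.induct) (simp_all add: B_simple_root B_refl_root)

text \<open>The Cartan entries are integers, so simple reflections preserve the root
  lattice.\<close>

lemma Phi_Ints: "\<gamma> \<in> Phi \<Longrightarrow> \<gamma> $ j \<in> \<int>"
proof (induction arbitrary: j rule: Phi.induct)
  case (simple i)
  then show ?case by (simp add: simple_root_def axis_def)
next
  case (reflect \<beta> i)
  have "B (simple_root i) \<beta> \<in> \<int>"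
    unfolding B_def simple_root_def axis_def cartan_def
    by (intro Ints_sum Ints_mult) (auto simp: reflect)
  then show ?case
    using reflect by (simp add: refl_root_def simple_root_def axis_def)
qed

lemma refl_root_refl_root:
  assumes "B \<alpha> \<alpha> = 2"
  shows "refl_root \<alpha> (refl_root \<alpha> x) = x"
  using assms by (simp add: refl_root_def B_diff_right B_scaleR_right)

lemma refl_root_conjugate:
  assumes "B \<alpha> \<alpha> = 2"
  shows "refl_root (refl_root \<alpha> \<beta>) x = refl_root \<alpha> (refl_root \<beta> (refl_root \<alpha> x))"
proof -
  have "B (refl_root \<alpha> \<beta>) x = B \<beta> (refl_root \<alpha> x)"
    using B_refl_root[OF assms, of \<beta> "refl_root \<alpha> x"] refl_root_refl_root[OF assms] by simp
  moreover have "refl_root \<alpha> (y - c *\<^sub>R \<beta>) = refl_root \<alpha> y - c *\<^sub>R refl_root \<alpha> \<beta>" for y c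
    by (simp add: refl_root_def B_diff_right B_scaleR_right algebra_simps)
  ultimately show ?thesis
    unfolding refl_root_def[of "refl_root \<alpha> \<beta>"] refl_root_def[of \<beta>]
    by (simp add: refl_root_refl_root[OF assms])
qed

text \<open>By construction \<open>Phi\<close> is closed only under simple reflections. Conjugation
  writes the reflection in \<open>refl_root \<alpha> \<beta>\<close> as a product of the reflections
  in \<alpha>, \<beta> and \<alpha>, and induction along the orbit extends closure to all
  roots.\<close>

lemma refl_root_Phi:
  assumes "\<beta> \<in> Phi" "\<gamma> \<in> Phi"
  shows "refl_root \<beta> \<gamma> \<in> Phi"
  using assms
proof (induction arbitrary: \<gamma> rule: Phi.induct)
  case (simple i)
  then show ?case by (rule Phi.reflect)
next
  case (reflect \<beta> i)
  then show ?case
    by (simp add: refl_root_conjugate[OF B_simple_root] Phi.reflect)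
qed


text \<open>The argument \<open>d\<close> is the coefficient of \<open>\<alpha>\<^sub>2\<close>, and \<open>g\<close> lists the coefficients along the path
  \<open>1, 3, 4, 5, 6, 7\<close> of the Dynkin diagram.\<close>

definition height_one_vec :: "real \<Rightarrow> (nat \<Rightarrow> real) \<Rightarrow> real^8" where
  "height_one_vec d g = vector [g 1, d, g 2, g 3, g 4, g 5, g 6, 0]"

text \<open>This and the next two vectors solve \<open>f \<gamma> = v i 7\<close>,
  \<open>f \<gamma> = v i 8\<close> and \<open>f \<gamma> = - v i j\<close>. The eighth coordinate
  of \<open>f\<close> fixes the \<open>\<alpha>\<^sub>2\<close>-coefficient as 2, 0 or 1; the first
  six prescribe the increments along the path, whose partial sums are the functions below.\<close>

definition vec_a :: "nat \<Rightarrow> real^8" where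
  "vec_a i = height_one_vec 2 (\<lambda>k. real (min k (6 - k)) + of_bool (i \<le> k))"

definition vec_b :: "nat \<Rightarrow> real^8" where
  "vec_b i = height_one_vec 0 (\<lambda>k. of_bool (i \<le> k))"

definition vec_c :: "nat \<Rightarrow> nat \<Rightarrow> real^8" where
  "vec_c i j = height_one_vec 1 (\<lambda>k. real (min k 3) - of_bool (i \<le> k) - of_bool (j \<le> k))"

lemma vec_c_commute: "vec_c i j = vec_c j i"
  by (simp add: vec_c_def algebra_simps)

lemma refl_simple_root_nth:
  "refl_root (simple_root n) x $ m = x $ m - of_bool (m = n) * B (simple_root n) x"
  by (simp add: refl_root_def simple_root_def axis_def)

lemma B_simple_root_left:
  "B (simple_root 1) x = 2 * x$1 - x$3"
  "B (simple_root 2) x = 2 * x$2 - x$4"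
  "B (simple_root 3) x = 2 * x$3 - x$1 - x$4"
  "B (simple_root 4) x = 2 * x$4 - x$2 - x$3 - x$5"
  "B (simple_root 5) x = 2 * x$5 - x$4 - x$6"
  "B (simple_root 6) x = 2 * x$6 - x$5 - x$7"
  "B (simple_root 7) x = 2 * x$7 - x$6 - x$8"
  "B (simple_root 8) x = 2 * x$8 - x$7"
  by (simp_all add: B_eq simple_root_def axis_def)

lemmas vec_simps = vec_a_def vec_b_def vec_c_def height_one_vec_def

section \<open>Explicit roots reached by simple reflections, and their inner products\<close>

lemma Phi_step:
  assumes "x \<in> Phi" "refl_root (simple_root n) x = y"
  shows "y \<in> Phi"
  using Phi.reflect assms by blast

text \<open>Starting from \<open>simple_root 7\<close>, each reflection in the next node of the path
  adds one simple root.\<close>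

lemma vec_b_Phi:
  shows "vec_b 6 \<in> Phi" "vec_b 5 \<in> Phi" "vec_b 4 \<in> Phi" "vec_b 3 \<in> Phi" "vec_b 2 \<in> Phi" "vec_b 1 \<in> Phi"
proof -
  have "vec_b 6 = simple_root 7"
    unfolding vec_eq_iff forall_8 by (simp add: vec_simps simple_root_def axis_def)
  then show 6: "vec_b 6 \<in> Phi"
    by (simp add: Phi.simple)
  show 5: "vec_b 5 \<in> Phi"
    by (rule Phi_step[OF 6, of 6], unfold vec_eq_iff forall_8)
       (simp add: vec_simps refl_simple_root_nth B_simple_root_left)
  show 4: "vec_b 4 \<in> Phi"
    by (rule Phi_step[OF 5, of 5], unfold vec_eq_iff forall_8)
       (simp add: vec_simps refl_simple_root_nth B_simple_root_left)
  show 3: "vec_b 3 \<in> Phi"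
    by (rule Phi_step[OF 4, of 4], unfold vec_eq_iff forall_8)
       (simp add: vec_simps refl_simple_root_nth B_simple_root_left)
  show 2: "vec_b 2 \<in> Phi"
    by (rule Phi_step[OF 3, of 3], unfold vec_eq_iff forall_8)
       (simp add: vec_simps refl_simple_root_nth B_simple_root_left)
  show 1: "vec_b 1 \<in> Phi"
    by (rule Phi_step[OF 2, of 1], unfold vec_eq_iff forall_8)
       (simp add: vec_simps refl_simple_root_nth B_simple_root_left)
qed

lemma f_nth:
  "f x $ 1 = 4 * x$1 - 2 * x$2 - 1"
  "f x $ 2 = 4 * (x$3 - x$1) - 2 * x$2 - 1"
  "f x $ 3 = 4 * (x$4 - x$3) - 2 * x$2 - 1"
  "f x $ 4 = 4 * (x$5 - x$4) + 2 * x$2 - 1"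
  "f x $ 5 = 4 * (x$6 - x$5) + 2 * x$2 - 1"
  "f x $ 6 = 4 * (x$7 - x$6) + 2 * x$2 - 1"
  "f x $ 7 = 2 * x$2 - 4 * x$7 + 3"
  "f x $ 8 = 3 - 2 * x$2"
  unfolding f_def Let_def refl_simple_root_nth
  by (simp_all add: alpha'_def eps_def axis_def algebra_simps)

text \<open>The vectors \<open>alpha' i\<close> have 16 times the Gram matrix of type
  \<open>E\<^sub>7\<close>, and the constant vector in \<open>f\<close> plays the role of the
  projection of \<open>\<alpha>\<^sub>8\<close> to their span. Its squared norm is 24 instead of 16
  * 2 = 32; the summand 8 restores the contribution of the component orthogonal to that
  span.\<close>

lemma f_inner:
  assumes "x$7 = 1" "x$8 = 0" "y$7 = 1" "y$8 = 0"
  shows "16 * B x y = f x \<bullet> f y + 8"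
  unfolding inner_vec_def sum_8 f_nth B_eq
  using assms by (simp add: algebra_simps)

lemma f_inject:
  assumes "x$7 = 1" "x$8 = 0" "y$7 = 1" "y$8 = 0" "f x = f y"
  shows "x = y"
proof -
  have "\<forall>i. f x $ i = f y $ i"
    using assms by simp
  then show ?thesis
    using assms unfolding vec_eq_iff[of x y] forall_8 f_nth by auto
qed

lemma nat_in_1_to_8: "i \<in> {1..8} \<longleftrightarrow> i = 1 \<or> i = 2 \<or> i = 3 \<or> i = 4 \<or> i = 5 \<or> i = 6 \<or> i = 7 \<or> i = (8::nat)"
  by auto

lemma nat_in_1_to_6: "i \<in> {1..6} \<longleftrightarrow> i = 1 \<or> i = 2 \<or> i = 3 \<or> i = 4 \<or> i = 5 \<or> i = (6::nat)"
  by auto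

lemma inner_eps:
  assumes "i \<in> {1..8}" "j \<in> {1..8}"
  shows "eps i \<bullet> eps j = of_bool (i = j)"
  using assms unfolding nat_in_1_to_8 eps_def inner_axis_axis
  by (elim disjE) simp_all

text \<open>Node 2 leads from \<open>vec_b 1\<close> to \<open>vec_c 2 3\<close> and from
  \<open>vec_c 5 6\<close> to \<open>vec_a 4\<close>, raising the
  \<open>\<alpha>\<^sub>2\<close>-coefficient by 1. Every other reflection changes one label by
  1.\<close>

lemma vec_c_vec_a_Phi:
  shows "\<forall>i\<in>{1..6}. \<forall>j\<in>{1..6}. i < j \<longrightarrow> vec_c i j \<in> Phi"
    and "\<forall>i\<in>{1..6}. vec_a i \<in> Phi"
proof -
  note step = vec_simps refl_simple_root_nth B_simple_root_left vec_eq_iff forall_8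
  have 23: "vec_c 2 3 \<in> Phi"
    by (rule Phi_step[OF vec_b_Phi(6), of 2]) (simp add: step)
  have 13: "vec_c 1 3 \<in> Phi" by (rule Phi_step[OF 23, of 1]) (simp add: step)
  have 12: "vec_c 1 2 \<in> Phi" by (rule Phi_step[OF 13, of 3]) (simp add: step)
  have 24: "vec_c 2 4 \<in> Phi" by (rule Phi_step[OF 23, of 4]) (simp add: step)
  have 25: "vec_c 2 5 \<in> Phi" by (rule Phi_step[OF 24, of 5]) (simp add: step)
  have 26: "vec_c 2 6 \<in> Phi" by (rule Phi_step[OF 25, of 6]) (simp add: step)
  have 34: "vec_c 3 4 \<in> Phi" by (rule Phi_step[OF 24, of 3]) (simp add: step)
  have 35: "vec_c 3 5 \<in> Phi" by (rule Phi_step[OF 25, of 3]) (simp add: step)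
  have 36: "vec_c 3 6 \<in> Phi" by (rule Phi_step[OF 26, of 3]) (simp add: step)
  have 14: "vec_c 1 4 \<in> Phi" by (rule Phi_step[OF 24, of 1]) (simp add: step)
  have 15: "vec_c 1 5 \<in> Phi" by (rule Phi_step[OF 25, of 1]) (simp add: step)
  have 16: "vec_c 1 6 \<in> Phi" by (rule Phi_step[OF 26, of 1]) (simp add: step)
  have 45: "vec_c 4 5 \<in> Phi" by (rule Phi_step[OF 35, of 4]) (simp add: step)
  have 46: "vec_c 4 6 \<in> Phi" by (rule Phi_step[OF 36, of 4]) (simp add: step)
  have 56: "vec_c 5 6 \<in> Phi" by (rule Phi_step[OF 46, of 5]) (simp add: step)
  have a4: "vec_a 4 \<in> Phi" by (rule Phi_step[OF 56, of 2]) (simp add: step)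
  have a3: "vec_a 3 \<in> Phi" by (rule Phi_step[OF a4, of 4]) (simp add: step)
  have a2: "vec_a 2 \<in> Phi" by (rule Phi_step[OF a3, of 3]) (simp add: step)
  have a1: "vec_a 1 \<in> Phi" by (rule Phi_step[OF a2, of 1]) (simp add: step)
  have a5: "vec_a 5 \<in> Phi" by (rule Phi_step[OF a4, of 5]) (simp add: step)
  have a6: "vec_a 6 \<in> Phi" by (rule Phi_step[OF a5, of 6]) (simp add: step)
  show "\<forall>i\<in>{1..6}. \<forall>j\<in>{1..6}. i < j \<longrightarrow> vec_c i j \<in> Phi"
    unfolding nat_in_1_to_6 Ball_def
    using 12 13 14 15 16 23 24 25 26 34 35 36 45 46 56 by fastforce
  show "\<forall>i\<in>{1..6}. vec_a i \<in> Phi"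
    unfolding nat_in_1_to_6 Ball_def using a1 a2 a3 a4 a5 a6 by blast
qed

lemma vec_a_U': "i \<in> {1..6} \<Longrightarrow> vec_a i \<in> U'"
proof -
  assume "i \<in> {1..6}"
  then have "vec_a i \<in> Phi" using vec_c_vec_a_Phi(2) by blast
  then show "vec_a i \<in> U'"
    using \<open>i \<in> {1..6}\<close> by (auto simp: U'_def Phi_pos_def height_at_def forall_8 vec_simps)
qed

lemma vec_b_U': "i \<in> {1..6} \<Longrightarrow> vec_b i \<in> U'"
proof -
  assume "i \<in> {1..6}"
  then have "vec_b i \<in> Phi" unfolding nat_in_1_to_6 using vec_b_Phi by blast
  then show "vec_b i \<in> U'"
    using \<open>i \<in> {1..6}\<close> by (auto simp: U'_def Phi_pos_def height_at_def forall_8 vec_simps)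
qed

lemma vec_c_U':
  assumes "i \<in> {1..6}" "j \<in> {1..6}" "i \<noteq> j"
  shows "vec_c i j \<in> U'"
proof -
  have "vec_c i j \<in> Phi"
    using vec_c_vec_a_Phi(1) assms vec_c_commute by (metis linorder_neqE_nat)
  then show "vec_c i j \<in> U'"
    using assms by (auto simp: U'_def Phi_pos_def height_at_def forall_8 vec_simps of_bool_def)
qed

lemma sum_eps: "(\<Sum>k = 1..8. eps k) = 1"
proof -
  have "{1..8} = {1,2,3,4,5,6,7,8::nat}" by auto
  then show ?thesis
    unfolding vec_eq_iff forall_8 by (simp add: eps_def axis_def)
qed

lemma inner_eps_one: "eps i \<bullet> 1 = 1" "1 \<bullet> eps i = 1"
  by (simp_all add: eps_def inner_axis inner_axis')

text \<open>The constant is -8 - 8 + 8: two cross terms with the all-ones vector and the squared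
  norm of that vector.\<close>

lemma inner_v:
  assumes "i \<in> {1..8}" "j \<in> {1..8}" "k \<in> {1..8}" "l \<in> {1..8}"
  shows "v i j \<bullet> v k l = 16 * (of_bool (i = k) + of_bool (i = l) + of_bool (j = k) + of_bool (j = l)) - 8"
proof -
  have "(1::real^8) \<bullet> 1 = 8"
    by (simp add: inner_vec_def)
  then show ?thesis
    unfolding v_def sum_eps using assms
    by (simp add: inner_eps inner_eps_one inner_add_left inner_add_right inner_diff_left inner_diff_right)
qed

lemma f_vec_a: "i \<in> {1..6} \<Longrightarrow> f (vec_a i) = v i 7"
  unfolding v_def sum_eps vec_eq_iff forall_8 f_nth nat_in_1_to_6
  by (elim disjE) (simp_all add: eps_def axis_def vec_simps)

lemma f_vec_b: "i \<in> {1..6} \<Longrightarrow> f (vec_b i) = v i 8"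
  unfolding v_def sum_eps vec_eq_iff forall_8 f_nth nat_in_1_to_6
  by (elim disjE) (simp_all add: eps_def axis_def vec_simps)

lemma f_vec_c: "i \<in> {1..6} \<Longrightarrow> j \<in> {1..6} \<Longrightarrow> i \<noteq> j \<Longrightarrow> f (vec_c i j) = - v i j"
  unfolding v_def sum_eps vec_eq_iff forall_8 f_nth nat_in_1_to_6
  by (elim disjE) (simp_all add: eps_def axis_def vec_simps)

lemma U'_f_inject:
  assumes "x \<in> U'" "y \<in> U'" "f x = f y"
  shows "x = y"
  using assms f_inject by (auto simp: U'_def height_at_def)

lemma root_a_eq: "i \<in> {1..6} \<Longrightarrow> root_a i = vec_a i"
  unfolding root_a_def by (rule the_equality) (auto simp: f_vec_a vec_a_U' intro: U'_f_inject)

lemma root_b_eq: "i \<in> {1..6} \<Longrightarrow> root_b i = vec_b i"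
  unfolding root_b_def by (rule the_equality) (auto simp: f_vec_b vec_b_U' intro: U'_f_inject)

lemma root_c_eq: "i \<in> {1..6} \<Longrightarrow> j \<in> {1..6} \<Longrightarrow> i \<noteq> j \<Longrightarrow> root_c i j = vec_c i j"
  unfolding root_c_def by (rule the_equality) (auto simp: f_vec_c vec_c_U' intro: U'_f_inject)

lemma B_U':
  assumes "x \<in> U'" "y \<in> U'"
  shows "B x y = (f x \<bullet> f y + 8) / 16"
  using assms f_inner[of x y] by (simp add: U'_def height_at_def)

context
  fixes i j :: nat
  assumes ij: "i \<in> {1..6}" "j \<in> {1..6}"
begin

lemma B_aa: "B (vec_a i) (vec_a j) = 1 + of_bool (i = j)"
  using ij by (simp add: B_U' vec_a_U' f_vec_a inner_v)

lemma B_bb: "B (vec_b i) (vec_b j) = 1 + of_bool (i = j)"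
  using ij by (simp add: B_U' vec_b_U' f_vec_b inner_v)

lemma B_ab: "B (vec_a i) (vec_b j) = of_bool (i = j)"
  using ij by (simp add: B_U' vec_a_U' vec_b_U' f_vec_a f_vec_b inner_v)

context
  fixes k :: nat
  assumes k: "k \<in> {1..6}" "j \<noteq> k"
begin

lemma B_ac: "B (vec_a i) (vec_c j k) = 1 - of_bool (i = j \<or> i = k)"
  using ij k by (auto simp: B_U' vec_a_U' vec_c_U' f_vec_a f_vec_c inner_v)

lemma B_bc: "B (vec_b i) (vec_c j k) = 1 - of_bool (i = j \<or> i = k)"
  using ij k by (auto simp: B_U' vec_b_U' vec_c_U' f_vec_b f_vec_c inner_v)

end

end

lemma B_cc:
  assumes "i \<in> {1..6}" "j \<in> {1..6}" "i \<noteq> j" "k \<in> {1..6}" "l \<in> {1..6}" "k \<noteq> l"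
  shows "B (vec_c i j) (vec_c k l) = of_bool (i = k \<or> i = l) + of_bool (j = k \<or> j = l)"
  using assms by (auto simp: B_U' vec_c_U' f_vec_c inner_v)


section \<open>Classification of the roots in \<open>U'\<close>\<close>

lemma int_zero_one_of_sum_eq_0:
  fixes t :: "'a \<Rightarrow> int"
  assumes "finite A" "(\<Sum>k\<in>A. t k * (t k - 1)) = 0"
  shows "\<forall>k\<in>A. t k = 0 \<or> t k = 1"
proof -
  \<comment> \<open>No integer lies strictly between 0 and 1, so the product is never negative and
    vanishes only at 0 and 1.\<close>
  have nonneg: "0 \<le> t k * (t k - 1)" for k
    by (cases "t k \<le> 0") (auto simp: mult_nonpos_nonpos)
  then have "\<forall>k\<in>A. t k * (t k - 1) = 0"
    using assms sum_nonneg_eq_0_iff[OF assms(1), of "\<lambda>k. t k * (t k - 1)"] by blast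
  then show ?thesis by auto
qed

lemma sum_1_to_6: "sum g {1..6::nat} = g 1 + g 2 + g 3 + g 4 + g 5 + g 6"
proof -
  have "{1..6} = {1,2,3,4,5,6::nat}" by auto
  then show ?thesis by (simp add: add.assoc)
qed

lemma sum_zero_one:
  fixes t :: "'a \<Rightarrow> int"
  assumes "finite A" "\<forall>k\<in>A. t k = 0 \<or> t k = 1"
  shows "sum t A = int (card {k \<in> A. t k = 1})"
proof -
  have "sum t A = (\<Sum>k\<in>A. of_bool (t k = 1))"
    using assms by (intro sum.cong) auto
  then show ?thesis
    using assms(1) by (simp add: Int_def)
qed

text \<open>Writing the coordinates of \<open>f \<gamma>\<close> as \<open>4 t\<^sub>k - 1\<close>, or as \<open>1 - 4 t\<^sub>k\<close> if the \<open>\<alpha>\<^sub>2\<close>-coefficient of \<open>\<gamma>\<close> is odd,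
  turns \<open>B(\<gamma>, \<gamma>) = 2\<close> into \<open>\<Sum>k. t\<^sub>k (t\<^sub>k - 1) = 0\<close>, so that every \<open>t\<^sub>k\<close> is \<open>0\<close> or \<open>1\<close>.\<close>

lemma U'_cases:
  assumes "\<gamma> \<in> U'"
  obtains (a) i where "i \<in> {1..6}" "\<gamma> = vec_a i"
    | (b) i where "i \<in> {1..6}" "\<gamma> = vec_b i"
    | (c) i j where "i \<in> {1..6}" "j \<in> {1..6}" "i \<noteq> j" "\<gamma> = vec_c i j"
proof -
  have Phi: "\<gamma> \<in> Phi" and 7: "\<gamma> $ 7 = 1" and 8: "\<gamma> $ 8 = 0"
    using assms by (auto simp: U'_def Phi_pos_def height_at_def)
  define x where "x k = \<lfloor>\<gamma> $ k\<rfloor>" for k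
  have x: "\<gamma> $ k = of_int (x k)" for k
    using Phi_Ints[OF Phi] by (simp add: x_def of_int_floor)
  have x7: "x 7 = 1" and x8: "x 8 = 0"
    using 7 8 by (simp_all add: x_def)
  \<comment> \<open>Both sides are kept under \<open>real_of_int\<close> so that the norm equation
    can be pulled back to the integers.\<close>
  have "real_of_int (2 * (x 1 * x 1 + x 2 * x 2 + x 3 * x 3 + x 4 * x 4 + x 5 * x 5 + x 6 * x 6 + 1)
      - 2 * (x 1 * x 3 + x 3 * x 4 + x 4 * x 5 + x 5 * x 6 + x 6 + x 2 * x 4)) = real_of_int 2"
    using B_Phi[OF Phi] 7 8 unfolding B_eq x by (simp add: algebra_simps)
  then have norm: "x 1 * x 1 + x 2 * x 2 + x 3 * x 3 + x 4 * x 4 + x 5 * x 5 + x 6 * x 6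
      = x 1 * x 3 + x 3 * x 4 + x 4 * x 5 + x 5 * x 6 + x 6 + x 2 * x 4"
    unfolding of_int_eq_iff by simp
  show thesis
  proof (cases "even (x 2)")
    case True
    then obtain m where m: "x 2 = 2 * m" by blast
    define t where "t k = (if k = 1 then x 1 - m else if k = 2 then x 3 - x 1 - m
      else if k = 3 then x 4 - x 3 - m else if k = 4 then x 5 - x 4 + m
      else if k = 5 then x 6 - x 5 + m else if k = 6 then 1 - x 6 + m
      else if k = 7 then m else 1 - m)" for k :: nat
    have "(\<Sum>k\<in>{1..6} \<union> {7,8}. t k * (t k - 1)) = 0"
      using norm unfolding m t_def
      by (subst sum.union_disjoint) (simp_all add: sum_1_to_6[unfolded One_nat_def] algebra_simps)
    then have t: "\<forall>k\<in>{1..6} \<union> {7,8}. t k = 0 \<or> t k = 1"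
      by (rule int_zero_one_of_sum_eq_0[rotated]) simp
    \<comment> \<open>The coordinates telescope along the path and the shifts by \<open>m\<close>
      cancel. Exactly one \<open>t k\<close> is therefore 1, and its index is the label.\<close>
    have "sum t {1..6} = 1"
      by (simp add: t_def sum_1_to_6[unfolded One_nat_def])
    then have "card {k \<in> {1..6}. t k = 1} = 1"
      using sum_zero_one[of "{1..6}" t] t by simp
    then obtain i where I: "{k \<in> {1..6}. t k = 1} = {i}"
      by (elim card_1_singletonE)
    then have i: "i \<in> {1..6}" by blast
    have t_eq: "t k = of_bool (k = i)" if "k \<in> {1..6}" for k
      using I t that by (auto simp: set_eq_iff)
    have "\<gamma> = height_one_vec (2 * of_int m) (\<lambda>k. of_int m * real (min k (6 - k)) + of_bool (i \<le> k))"
      using t_eq[of 1] t_eq[of 2] t_eq[of 3] t_eq[of 4] t_eq[of 5] t_eq[of 6] i x7 x8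
      unfolding vec_eq_iff forall_8 x nat_in_1_to_6
      by (elim disjE) (simp_all add: m t_def height_one_vec_def)
    \<comment> \<open>This is the condition on \<open>t 7\<close>; the value 0 gives the roots
      \<open>vec_b i\<close> and 1 the roots \<open>vec_a i\<close>.\<close>
    moreover have "m = 0 \<or> m = 1"
      using t by (simp add: t_def)
    ultimately show thesis
      using a b i by (auto simp: vec_a_def vec_b_def)
  next
    case False
    then obtain m where m: "x 2 = 2 * m + 1" by (elim oddE)
    define t where "t k = (if k = 1 then 1 + m - x 1 else if k = 2 then 1 + m + x 1 - x 3
      else if k = 3 then 1 + m + x 3 - x 4 else if k = 4 then x 4 - x 5 - m
      else if k = 5 then x 5 - x 6 - m else if k = 6 then x 6 - 1 - m
      else if k = 7 then - m else m)" for k :: nat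
    have "(\<Sum>k\<in>{1..6} \<union> {7,8}. t k * (t k - 1)) = 0"
      using norm unfolding m t_def
      by (subst sum.union_disjoint) (simp_all add: sum_1_to_6[unfolded One_nat_def] algebra_simps)
    then have t: "\<forall>k\<in>{1..6} \<union> {7,8}. t k = 0 \<or> t k = 1"
      by (rule int_zero_one_of_sum_eq_0[rotated]) simp
    \<comment> \<open>Both \<open>t 7 = - m\<close> and \<open>t 8 = m\<close> have to lie in {0,
      1}.\<close>
    then have m0: "m = 0"
      by (auto simp: t_def)
    \<comment> \<open>Again the sum telescopes, now to 2, which leaves two labels.\<close>
    have "sum t {1..6} = 2"
      by (simp add: t_def sum_1_to_6[unfolded One_nat_def] m0)
    then have "card {k \<in> {1..6}. t k = 1} = 2"
      using sum_zero_one[of "{1..6}" t] t by simp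
    then obtain i j where I: "{k \<in> {1..6}. t k = 1} = {i, j}" and ne: "i \<noteq> j"
      by (auto simp: card_2_iff)
    then have ij: "i \<in> {1..6}" "j \<in> {1..6}" by blast+
    have t_eq: "t k = of_bool (k = i) + of_bool (k = j)" if "k \<in> {1..6}" for k
      using I t that ne by (auto simp: set_eq_iff)
    have "\<gamma> = vec_c i j"
      using t_eq[of 1] t_eq[of 2] t_eq[of 3] t_eq[of 4] t_eq[of 5] t_eq[of 6] ij ne x7 x8
      unfolding vec_eq_iff forall_8 x nat_in_1_to_6
      by (elim disjE) (simp_all add: m m0 t_def vec_c_def height_one_vec_def)
    then show thesis
      using c ij ne by blast
  qed
qed


section \<open>Residues of single roots\<close>

lemma ball_1_to_6:
  "(\<forall>k\<in>{1..6::nat}. P k) \<longleftrightarrow> P 1 \<and> P 2 \<and> P 3 \<and> P 4 \<and> P 5 \<and> P 6"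
  unfolding Ball_def nat_in_1_to_6 by blast

lemma height_one_vec_le_iff:
  "height_one_vec d g \<le> height_one_vec d' g' \<longleftrightarrow> d \<le> d' \<and> (\<forall>k\<in>{1..6}. g k \<le> g' k)"
  unfolding less_eq_vec_def forall_8 height_one_vec_def ball_1_to_6
  by (simp only: vector_8 order_refl) blast

text \<open>The negative statements follow from the \<open>\<alpha>\<^sub>2\<close>-coefficients 2,
  1, 0 of \<open>vec_a\<close>, \<open>vec_c\<close>, \<open>vec_b\<close>. In the first two
  equivalences only the positions where the indicators jump matter.\<close>

lemma vec_le:
  "i \<in> {1..6} \<Longrightarrow> vec_a i \<le> vec_a h \<longleftrightarrow> h \<le> i"
  "i \<in> {1..6} \<Longrightarrow> vec_b i \<le> vec_b h \<longleftrightarrow> h \<le> i"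
  "vec_b i \<le> vec_a i"
  "\<not> vec_a i \<le> vec_b h" "\<not> vec_a i \<le> vec_c k l" "\<not> vec_c k l \<le> vec_b i"
  unfolding vec_a_def vec_b_def vec_c_def height_one_vec_le_iff by (auto simp: of_bool_def)

text \<open>The indicator of the shared label cancels. The others carry a minus sign, so the order
  is opposite to that of \<open>vec_a\<close> and \<open>vec_b\<close>.\<close>

lemma vec_c_le_vec_c:
  assumes "i \<in> {1..6}" "j \<in> {1..6}"
  shows "vec_c i k \<le> vec_c j k \<longleftrightarrow> i \<le> j" "vec_c i k \<le> vec_c k j \<longleftrightarrow> i \<le> j"
    "vec_c k i \<le> vec_c j k \<longleftrightarrow> i \<le> j" "vec_c k i \<le> vec_c k j \<longleftrightarrow> i \<le> j"
proof -
  have "vec_c i k \<le> vec_c j k \<longleftrightarrow> (\<forall>l\<in>{1..6}. j \<le> l \<longrightarrow> i \<le> l)"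
    unfolding vec_c_def height_one_vec_le_iff by (auto simp: of_bool_def)
  also have "\<dots> \<longleftrightarrow> i \<le> j"
    using assms(2) by auto
  finally show "vec_c i k \<le> vec_c j k \<longleftrightarrow> i \<le> j" .
  then show "vec_c i k \<le> vec_c k j \<longleftrightarrow> i \<le> j" "vec_c k i \<le> vec_c j k \<longleftrightarrow> i \<le> j"
    "vec_c k i \<le> vec_c k j \<longleftrightarrow> i \<le> j"
    by (simp_all only: vec_c_commute[of k])
qed

text \<open>Positions 4, 5 and 6 of the path require at least 1, 2 and 3 of the labels i, k, l to be
  at most the position; three distinct labels in \<open>{1..6}\<close> satisfy this.\<close>

lemma vec_c_le_vec_a:
  assumes "i \<in> {1..6}" "k \<in> {1..6}" "l \<in> {1..6}" "i \<noteq> k" "i \<noteq> l" "k \<noteq> l"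
  shows "vec_c k l \<le> vec_a i"
  unfolding vec_a_def vec_c_def height_one_vec_le_iff Ball_def nat_in_1_to_6
  using assms by (auto simp: of_bool_def)

text \<open>Of three distinct positive labels at most \<open>min p 3\<close> are at most
  \<open>p\<close>, which is the inequality at position \<open>p\<close>.\<close>

lemma vec_b_le_vec_c:
  assumes "i \<in> {1..6}" "k \<in> {1..6}" "l \<in> {1..6}" "i \<noteq> k" "i \<noteq> l" "k \<noteq> l"
  shows "vec_b i \<le> vec_c k l"
  unfolding vec_b_def vec_c_def height_one_vec_le_iff Ball_def nat_in_1_to_6
  using assms by (auto simp: of_bool_def)

lemma U'_Phi: "\<gamma> \<in> U' \<Longrightarrow> \<gamma> \<in> Phi"
  by (simp add: U'_def Phi_pos_def)

lemma B_U'_values: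
  assumes "\<beta> \<in> U'" "\<gamma> \<in> U'"
  shows "B \<beta> \<gamma> = 0 \<or> B \<beta> \<gamma> = 1 \<or> B \<beta> \<gamma> = 2"
  by (rule U'_cases[OF assms(1)]; rule U'_cases[OF assms(2)])
     (auto simp: B_aa B_bb B_ab B_ac B_bc B_cc B_commute[of "vec_b _" "vec_a _"]
       B_commute[of "vec_c _ _" "vec_a _"] B_commute[of "vec_c _ _" "vec_b _"] of_bool_def)

lemma refl_root_Phi_pos_iff:
  assumes "\<beta> \<in> U'" "\<gamma> \<in> U'"
  shows "refl_root \<beta> \<gamma> \<in> Phi_pos \<longleftrightarrow> B \<beta> \<gamma> = 0 \<or> B \<beta> \<gamma> = 1 \<and> \<beta> \<le> \<gamma>"
proof -
  have Phi: "refl_root \<beta> \<gamma> \<in> Phi"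
    using assms by (intro refl_root_Phi U'_Phi)
  \<comment> \<open>Both roots have 7-height 1, so for inner product 2 the reflected root has
    7-height -1.\<close>
  have "refl_root \<beta> \<gamma> $ 7 = 1 - B \<beta> \<gamma>"
    using assms by (simp add: refl_root_def U'_def height_at_def)
  then have 2: "refl_root \<beta> \<gamma> \<notin> Phi_pos" if "B \<beta> \<gamma> = 2"
    using that by (auto simp: Phi_pos_def intro!: exI[of _ 7])
  from B_U'_values[OF assms] show ?thesis
  proof (elim disjE)
    assume "B \<beta> \<gamma> = 0"
    then show ?thesis
      using assms by (simp add: refl_root_def U'_def)
  next
    assume "B \<beta> \<gamma> = 1"
    then show ?thesis
      using Phi by (simp add: Phi_pos_def less_eq_vec_def refl_root_def)
  next
    assume "B \<beta> \<gamma> = 2"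
    then show ?thesis using 2 by simp
  qed
qed

lemma refl_root_vec_Phi_pos:
  assumes "i \<in> {1..6}" "h \<in> {1..6}"
  shows "refl_root (vec_a i) (vec_a h) \<in> Phi_pos \<longleftrightarrow> h < i"
    and "refl_root (vec_a i) (vec_b h) \<in> Phi_pos \<longleftrightarrow> h \<noteq> i"
    and "refl_root (vec_b i) (vec_a h) \<in> Phi_pos"
    and "refl_root (vec_b i) (vec_b h) \<in> Phi_pos \<longleftrightarrow> h < i"
  using assms
  by (auto simp: refl_root_Phi_pos_iff vec_a_U' vec_b_U' B_aa B_bb B_ab B_commute[of "vec_b _" "vec_a _"]
      vec_le of_bool_def)

text \<open>Among non-orthogonal pairs \<open>vec_c\<close> always lies below \<open>vec_a\<close>
  and above \<open>vec_b\<close>. Reflecting the larger root is thus always allowed, and reflecting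
  the smaller one only in the orthogonal case.\<close>

lemma refl_root_vec_c_Phi_pos:
  assumes "i \<in> {1..6}" "k \<in> {1..6}" "l \<in> {1..6}" "k \<noteq> l"
  shows "refl_root (vec_a i) (vec_c k l) \<in> Phi_pos \<longleftrightarrow> i = k \<or> i = l"
    and "refl_root (vec_c k l) (vec_a i) \<in> Phi_pos"
    and "refl_root (vec_b i) (vec_c k l) \<in> Phi_pos"
    and "refl_root (vec_c k l) (vec_b i) \<in> Phi_pos \<longleftrightarrow> i = k \<or> i = l"
  using assms vec_c_le_vec_a[OF assms(1-3)] vec_b_le_vec_c[OF assms(1-3)]
  by (auto simp: refl_root_Phi_pos_iff vec_a_U' vec_b_U' vec_c_U' B_ac B_bc
      B_commute[of "vec_c _ _" "vec_a _"] B_commute[of "vec_c _ _" "vec_b _"]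
      vec_le of_bool_def)

text \<open>One shared label gives inner product 1 and leaves the comparison to the other two
  labels. For equal roots the strict inequalities fail, in agreement with inner product 2.\<close>

lemma refl_root_vec_c_vec_c_Phi_pos:
  assumes "i \<in> {1..6}" "j \<in> {1..6}" "i \<noteq> j" "p \<in> {1..6}" "q \<in> {1..6}" "p \<noteq> q"
  shows "refl_root (vec_c i j) (vec_c p q) \<in> Phi_pos \<longleftrightarrow>
    (p = i \<longrightarrow> j < q) \<and> (p = j \<longrightarrow> i < q) \<and> (q = i \<longrightarrow> j < p) \<and> (q = j \<longrightarrow> i < p)"
  using assms by (auto simp: refl_root_Phi_pos_iff vec_c_U' B_cc vec_c_le_vec_c less_le of_bool_def)


section \<open>Coxeter length and inversions\<close>

definition inversions :: "nat \<Rightarrow> (nat \<Rightarrow> nat) \<Rightarrow> (nat \<times> nat) set" where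
  "inversions n w = {(x, y). x \<in> {1..n} \<and> y \<in> {1..n} \<and> x < y \<and> w y < w x}"

lemma finite_inversions: "finite (inversions n w)"
  by (rule finite_subset[of _ "{1..n} \<times> {1..n}"]) (auto simp: inversions_def)

text \<open>No third number lies between k and k + 1, so exchanging them reverses no order but their
  own.\<close>

lemma transpose_Suc_less_iff:
  assumes "a \<noteq> b" "{a, b} \<noteq> {k, k + 1}"
  shows "Transposition.transpose k (k + 1) a < Transposition.transpose k (k + 1) b \<longleftrightarrow> a < (b::nat)"
  using assms by (auto simp: Transposition.transpose_def doubleton_eq_iff)

text \<open>Composition on the left exchanges the values k and k + 1, which affects only the pair of
  positions where they are taken.\<close>

lemma inversions_transpose:
  assumes w: "w permutes {1..n}" and k: "k \<in> {1..<n}"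
    and x: "x \<in> {1..n}" "w x = k" and y: "y \<in> {1..n}" "w y = k + 1" and "x < y"
  shows "inversions n (Transposition.transpose k (k + 1) \<circ> w) = insert (x, y) (inversions n w)"
    and "(x, y) \<notin> inversions n w"
proof -
  let ?s = "Transposition.transpose k (k + 1)"
  have inj: "w a = w b \<longleftrightarrow> a = b" for a b
    using permutes_inj[OF w] by (simp add: inj_eq)
  have "(a, b) \<in> inversions n (?s \<circ> w) \<longleftrightarrow> (a, b) \<in> insert (x, y) (inversions n w)" for a b
  proof (cases "{w b, w a} = {k, k + 1}")
    case True
    then have "{a, b} = {x, y}"
      using x y inj by (metis doubleton_eq_iff)
    then show ?thesis
      using x y \<open>x < y\<close> by (auto simp: inversions_def doubleton_eq_iff)
  next
    case False
    then have "(a, b) \<noteq> (x, y)" using x y by auto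
    then show ?thesis
      using False transpose_Suc_less_iff[of "w b" "w a" k] inj[of b a]
      by (cases "a = b") (auto simp: inversions_def)
  qed
  then show "inversions n (?s \<circ> w) = insert (x, y) (inversions n w)" by auto
  show "(x, y) \<notin> inversions n w"
    using x y by (simp add: inversions_def)
qed

lemma transpose_permutes_interval:
  fixes k n :: nat
  assumes "k \<in> {1..<n}"
  shows "Transposition.transpose k (k + 1) permutes {1..n}"
  using assms by (intro permutes_swap_id) auto

lemma transpose_permutes_preimage:
  assumes "w permutes S" "k \<in> S"
  obtains x where "x \<in> S" "w x = k"
  using assms permutes_image by (metis imageE)

text \<open>The second claim ensures that the truncated subtraction in the first is a true
  one.\<close>

lemma card_inversions_transpose:
  assumes w: "w permutes {1..n}" and k: "k \<in> {1..<n}"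
  shows "card (inversions n (Transposition.transpose k (k + 1) \<circ> w))
    = (if inv w k < inv w (k + 1) then card (inversions n w) + 1 else card (inversions n w) - 1)"
    and "inv w (k + 1) < inv w k \<Longrightarrow> inversions n w \<noteq> {}"
proof -
  let ?s = "Transposition.transpose k (k + 1)"
  have sw: "?s \<circ> w permutes {1..n}"
    using w transpose_permutes_interval[OF k] by (rule permutes_compose)
  obtain x where x: "x \<in> {1..n}" "w x = k"
    using transpose_permutes_preimage[OF w, of k] k by auto
  obtain y where y: "y \<in> {1..n}" "w y = k + 1"
    using transpose_permutes_preimage[OF w, of "k + 1"] k by auto
  have inv: "inv w k = x" "inv w (k + 1) = y"
    using x y permutes_inv_eq[OF w] by simp_all
  have "x \<noteq> y" using x y by auto
  \<comment> \<open>The descending case is the ascending case for \<open>?s \<circ> w\<close>, since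
    \<open>?s\<close> is an involution.\<close>
  have "inversions n w = insert (y, x) (inversions n (?s \<circ> w)) \<and> (y, x) \<notin> inversions n (?s \<circ> w)"
    if "y < x"
    using inversions_transpose[OF sw k, of y x] that x y by (simp add: o_assoc)
  then show "card (inversions n (?s \<circ> w))
      = (if inv w k < inv w (k + 1) then card (inversions n w) + 1 else card (inversions n w) - 1)"
    and "inv w (k + 1) < inv w k \<Longrightarrow> inversions n w \<noteq> {}"
    using inversions_transpose[OF w k x y] inv \<open>x \<noteq> y\<close>
    by (auto simp: finite_inversions linorder_not_less le_less)
qed

definition word_perm :: "nat list \<Rightarrow> nat \<Rightarrow> nat" where
  "word_perm ks = foldr (\<lambda>k u. Transposition.transpose k (k + 1) \<circ> u) ks id"

lemma word_perm_simps:
  "word_perm [] = id"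
  "word_perm (k # ks) = Transposition.transpose k (k + 1) \<circ> word_perm ks"
  by (simp_all add: word_perm_def)

lemma word_perm_permutes:
  "set ks \<subseteq> {1..<n} \<Longrightarrow> word_perm ks permutes {1..n}"
proof (induction ks)
  case Nil
  then show ?case unfolding word_perm_simps by (simp only: permutes_id)
next
  case (Cons k ks)
  then show ?case
    using transpose_permutes_interval[of k n] permutes_compose
    unfolding word_perm_simps(2) by (metis insert_subset list.simps(15))
qed

text \<open>Each letter creates at most one inversion; this is the lower bound for the Coxeter
  length.\<close>

lemma card_inversions_word_perm_le:
  "set ks \<subseteq> {1..<n} \<Longrightarrow> card (inversions n (word_perm ks)) \<le> length ks"
proof (induction ks)
  case Nil
  have "inversions n id = {}" by (auto simp: inversions_def)
  then show ?case unfolding word_perm_simps by (metis card.empty le0)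
next
  case (Cons k ks)
  then have "set ks \<subseteq> {1..<n}" "k \<in> {1..<n}" by auto
  then have "card (inversions n (word_perm (k # ks))) \<le> card (inversions n (word_perm ks)) + 1"
    by (simp only: word_perm_simps card_inversions_transpose(1)[OF word_perm_permutes])
      (use le_add1 diff_le_self order_trans in \<open>auto split: if_split\<close>)
  then show ?case
    using Cons.IH[OF \<open>set ks \<subseteq> {1..<n}\<close>] by simp
qed

text \<open>As long as some k has a descent of the inverse, multiplying by the transposition removes
  one inversion and supplies one letter.\<close>

lemma ex_reduced_word:
  assumes "w permutes {1..n}"
  shows "\<exists>ks. length ks = card (inversions n w) \<and> set ks \<subseteq> {1..<n} \<and> w = word_perm ks"
  using assms
proof (induction "card (inversions n w)" arbitrary: w rule: less_induct)
  case less
  show ?case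
  proof (cases "\<exists>k\<in>{1..<n}. inv w (k + 1) < inv w k")
    case True
    then obtain k where k: "k \<in> {1..<n}" "inv w (k + 1) < inv w k" by blast
    let ?s = "Transposition.transpose k (k + 1)"
    have "card (inversions n w) > 0"
      using card_inversions_transpose(2)[OF less.prems k] by (simp add: finite_inversions card_gt_0_iff)
    moreover have c: "card (inversions n (?s \<circ> w)) = card (inversions n w) - 1"
      using card_inversions_transpose(1)[OF less.prems k(1)] k(2) by simp
    moreover have "?s \<circ> w permutes {1..n}"
      using less.prems transpose_permutes_interval[OF k(1)] by (rule permutes_compose)
    ultimately obtain ks where ks: "length ks = card (inversions n w) - 1" "set ks \<subseteq> {1..<n}"
        "?s \<circ> w = word_perm ks"
      using less.hyps[of "?s \<circ> w"] by auto
    have "w = ?s \<circ> (?s \<circ> w)" by (simp add: o_assoc)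
    then have "w = word_perm (k # ks)" using ks(3) by (simp add: word_perm_simps)
    then show ?thesis
      using ks k(1) \<open>card (inversions n w) > 0\<close> by (intro exI[of _ "k # ks"]) auto
  next
    case False
    have inv: "inv w permutes {1..n}" using less.prems by (rule permutes_inv)
    \<comment> \<open>Without descents the inverse increases strictly from a value of at least 1. A
      permutation of \<open>{1..n}\<close> that lies above the identity everywhere is the
      identity.\<close>
    have "k \<le> inv w k" if "1 \<le> k" "k \<le> n" for k
      using that
    proof (induction k rule: dec_induct)
      case base
      then show ?case using permutes_in_image[OF inv, of 1] by simp
    next
      case (step k)
      then have "inv w k \<le> inv w (k + 1)" using False
        by (metis Suc_eq_plus1 Suc_le_eq atLeastLessThan_iff not_less step.hyps(1))
      moreover have "inv w k \<noteq> inv w (k + 1)"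
        using permutes_inj[OF inv] by (simp add: inj_eq)
      ultimately show ?case using step by simp
    qed
    then have "inv w = id"
      using permutes_natset_ge[OF inv] by simp
    then have "w = id"
      using permutes_inv_inv[OF less.prems] by (metis inv_id)
    then have "inversions n w = {}" by (auto simp: inversions_def)
    then show ?thesis
      using \<open>w = id\<close> by (intro exI[of _ "[]"]) (simp add: word_perm_simps)
  qed
qed

lemma coxeter_length_eq_card_inversions:
  assumes "w permutes {1..n}"
  shows "coxeter_length n w = card (inversions n w)"
  unfolding coxeter_length_def word_perm_def[symmetric]
proof (rule Least_equality)
  show "\<exists>ks. length ks = card (inversions n w) \<and> set ks \<subseteq> {1..<n} \<and> w = word_perm ks"
    using ex_reduced_word[OF assms] .
next
  fix l
  assume "\<exists>ks. length ks = l \<and> set ks \<subseteq> {1..<n} \<and> w = word_perm ks"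
  then show "card (inversions n w) \<le> l"
    using card_inversions_word_perm_le by blast
qed

section \<open>Inversions of fixed point free involutions\<close>

lemma card_swap_closed:
  fixes R :: "('a::linorder \<times> 'a) set"
  assumes "finite R" "\<And>p q. (p, q) \<in> R \<Longrightarrow> (q, p) \<in> R" "\<And>p. (p, p) \<notin> R"
  shows "card R = 2 * card {(p, q) \<in> R. p < q}"
proof -
  have "R = {(p, q) \<in> R. p < q} \<union> prod.swap ` {(p, q) \<in> R. p < q}"
  proof (intro equalityI subsetI)
    fix z assume "z \<in> R"
    moreover obtain p q where "z = (p, q)" by fastforce
    ultimately show "z \<in> {(p, q) \<in> R. p < q} \<union> prod.swap ` {(p, q) \<in> R. p < q}"
      using assms(2)[of p q] assms(3)[of p] by (cases p q rule: linorder_cases) (auto simp: image_iff)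
  qed (use assms(2) in auto)
  moreover have "card (prod.swap ` {(p, q) \<in> R. p < q}) = card {(p, q) \<in> R. p < q}"
    by (simp add: card_image)
  moreover have "card ({(p, q) \<in> R. p < q} \<union> prod.swap ` {(p, q) \<in> R. p < q})
      = card {(p, q) \<in> R. p < q} + card (prod.swap ` {(p, q) \<in> R. p < q})"
    using assms(1) by (intro card_Un_disjoint) (auto intro: finite_subset)
  ultimately show ?thesis by simp
qed

text \<open>The identity is doubled so that n / 2 does not occur as a division of natural
  numbers.\<close>

lemma coxeter_length_fixed_point_free_involution:
  assumes perm: "\<tau> permutes {1..n}" and invol: "\<And>x. \<tau> (\<tau> x) = x"
    and fpf: "\<And>x. x \<in> {1..n} \<Longrightarrow> \<tau> x \<noteq> x"
  shows "2 * coxeter_length n \<tau>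
    = n + 4 * card {(p, q) \<in> {1..n} \<times> {1..n}. \<tau> p < q \<and> \<tau> q < p \<and> p < q}"
proof -
  let ?V = "{1..n}"
  define Q where "Q = {(p, q) \<in> ?V \<times> ?V. \<tau> p < q \<and> \<tau> q < p}"
  have mem: "\<tau> x \<in> ?V \<longleftrightarrow> x \<in> ?V" for x
    using permutes_in_image[OF perm] .
  \<comment> \<open>With p = \<tau> x and q = y, the inversion conditions x < y and \<tau> y <
    \<tau> x become \<tau> p < q and \<tau> q < p.\<close>
  have "bij_betw (\<lambda>(x, y). (\<tau> x, y)) (inversions n \<tau>) Q"
    by (rule bij_betw_byWitness[where f' = "\<lambda>(x, y). (\<tau> x, y)"])
       (use mem invol in \<open>auto simp: inversions_def Q_def simp del: atLeastAtMost_iff\<close>)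
  then have inv: "card (inversions n \<tau>) = card Q"
    by (rule bij_betw_same_card)
  have "finite Q"
    by (rule finite_subset[of _ "?V \<times> ?V"]) (auto simp: Q_def)
  then have fin: "finite {(p, q) \<in> Q. p \<noteq> q}"
    by (rule rev_finite_subset) auto
  define D where "D = {p \<in> ?V. \<tau> p < p}"
  have "Q = (\<lambda>p. (p, p)) ` D \<union> {(p, q) \<in> Q. p \<noteq> q}"
    by (auto simp: Q_def D_def)
  then have "card Q = card ((\<lambda>p. (p, p)) ` D \<union> {(p, q) \<in> Q. p \<noteq> q})"
    by simp
  also have "\<dots> = card ((\<lambda>p. (p, p)) ` D) + card {(p, q) \<in> Q. p \<noteq> q}"
    using fin by (intro card_Un_disjoint) (auto simp: D_def)
  also have "card ((\<lambda>p. (p, p)) ` D) = card D"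
    by (intro card_image inj_onI) simp
  also have "card {(p, q) \<in> Q. p \<noteq> q} = 2 * card {(p, q) \<in> {(p, q) \<in> Q. p \<noteq> q}. p < q}"
    using fin by (rule card_swap_closed) (auto simp: Q_def)
  also have "{(p, q) \<in> {(p, q) \<in> Q. p \<noteq> q}. p < q}
      = {(p, q) \<in> ?V \<times> ?V. \<tau> p < q \<and> \<tau> q < p \<and> p < q}"
    by (auto simp: Q_def)
  finally have "card Q = card D + 2 * card {(p, q) \<in> ?V \<times> ?V. \<tau> p < q \<and> \<tau> q < p \<and> p < q}" .
  moreover have "2 * card D = n"
  proof -
    \<comment> \<open>\<open>D\<close> contains the larger element of each two-cycle, and \<tau>
      maps it to the smaller one.\<close>
    have "?V = D \<union> \<tau> ` D"
    proof (intro equalityI subsetI)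
      fix x assume "x \<in> ?V"
      then have "x \<in> D \<or> \<tau> x \<in> D"
        using fpf[of x] mem[of x] invol[of x] unfolding D_def by (auto simp: linorder_neq_iff)
      then show "x \<in> D \<union> \<tau> ` D"
        using invol by (metis UnI1 UnI2 imageI)
    qed (use mem in \<open>auto simp: D_def simp del: atLeastAtMost_iff\<close>)
    then have "n = card (D \<union> \<tau> ` D)"
      by (metis card_atLeastAtMost diff_Suc_1)
    also have "\<dots> = card D + card (\<tau> ` D)"
      by (intro card_Un_disjoint) (auto simp: D_def invol)
    also have "card (\<tau> ` D) = card D"
      using permutes_inj[OF perm] by (intro card_image) (auto intro: inj_on_subset)
    finally show ?thesis by simp
  qed
  ultimately show ?thesis
    using coxeter_length_eq_card_inversions[OF perm] inv by simp
qed


section \<open>Residue sets of orthogonal triples\<close>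

text \<open>The root \<open>vec_a i\<close> leaves \<open>vec_a h\<close> with h < i and, among the
  roots \<open>vec_c\<close>, those with label i; \<open>vec_c i j\<close> cuts the latter down to k
  > j. The condition k \<noteq> i lets one formula serve both orders of i and j.\<close>

lemma Res_vec_acb:
  assumes "i \<in> {1..6}" "j \<in> {1..6}" "i \<noteq> j"
  shows "Res U' {vec_a i, vec_c i j, vec_b j} =
    vec_a ` {1..<i} \<union> vec_c i ` {k \<in> {1..6}. j < k \<and> k \<noteq> i}"
proof (intro equalityI subsetI)
  fix \<gamma> assume "\<gamma> \<in> Res U' {vec_a i, vec_c i j, vec_b j}"
  then have U: "\<gamma> \<in> U'" and a: "refl_root (vec_a i) \<gamma> \<in> Phi_pos"
    and c: "refl_root (vec_c i j) \<gamma> \<in> Phi_pos" and b: "refl_root (vec_b j) \<gamma> \<in> Phi_pos"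
    by (auto simp: Res_def)
  from U show "\<gamma> \<in> vec_a ` {1..<i} \<union> vec_c i ` {k \<in> {1..6}. j < k \<and> k \<noteq> i}"
  proof (cases rule: U'_cases)
    case (a h)
    then show ?thesis using \<open>refl_root (vec_a i) \<gamma> \<in> Phi_pos\<close> assms
      by (auto simp: refl_root_vec_Phi_pos)
  next
    case (b h)
    \<comment> \<open>No \<open>vec_b h\<close> survives: \<open>vec_c i j\<close> leaves only the
      labels i and j, \<open>vec_a i\<close> excludes i, and \<open>vec_b j\<close> excludes
      j.\<close>
    then have "h \<noteq> i" "h = i \<or> h = j" "h < j"
      using assms a c \<open>refl_root (vec_b j) \<gamma> \<in> Phi_pos\<close>
      by (auto simp: refl_root_vec_Phi_pos refl_root_vec_c_Phi_pos)
    then show ?thesis by simp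
  next
    case (c k l)
    then have "i = k \<or> i = l"
      using assms a by (auto simp: refl_root_vec_c_Phi_pos)
    then show ?thesis
    proof
      assume "i = k"
      then have "j < l"
        using assms c \<open>refl_root (vec_c i j) \<gamma> \<in> Phi_pos\<close> by (auto simp: refl_root_vec_c_vec_c_Phi_pos)
      then show ?thesis using c \<open>i = k\<close> by auto
    next
      assume "i = l"
      then have "j < k"
        using assms c \<open>refl_root (vec_c i j) \<gamma> \<in> Phi_pos\<close> by (auto simp: refl_root_vec_c_vec_c_Phi_pos)
      then show ?thesis using c \<open>i = l\<close> vec_c_commute by auto
    qed
  qed
next
  fix \<gamma> assume "\<gamma> \<in> vec_a ` {1..<i} \<union> vec_c i ` {k \<in> {1..6}. j < k \<and> k \<noteq> i}"
  then show "\<gamma> \<in> Res U' {vec_a i, vec_c i j, vec_b j}"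
    using assms unfolding Res_def
    by (auto simp: refl_root_vec_Phi_pos refl_root_vec_c_Phi_pos refl_root_vec_c_vec_c_Phi_pos
        vec_a_U' vec_c_U')
qed

lemma vec_a_inject: "i \<in> {1..6} \<Longrightarrow> j \<in> {1..6} \<Longrightarrow> vec_a i = vec_a j \<longleftrightarrow> i = j"
  using vec_le(1) by (metis order_antisym order_refl)

lemma vec_c_eqI: "{i, j} = {k, l} \<Longrightarrow> vec_c i j = vec_c k l"
  using vec_c_commute by (auto simp: doubleton_eq_iff)

text \<open>Equal roots have inner product 2, which \<open>B_cc\<close> attains only when both
  labels of one root occur in the other.\<close>

lemma vec_c_inject:
  assumes "i \<in> {1..6}" "j \<in> {1..6}" "i \<noteq> j" "k \<in> {1..6}" "l \<in> {1..6}" "k \<noteq> l"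
  shows "vec_c i j = vec_c k l \<longleftrightarrow> {i, j} = {k, l}"
proof
  assume "vec_c i j = vec_c k l"
  then have "B (vec_c i j) (vec_c k l) = 2"
    using B_cc[of i j i j] assms by simp
  then show "{i, j} = {k, l}"
    using assms by (auto simp: B_cc of_bool_def split: if_splits)
qed (rule vec_c_eqI)

lemma vec_neq:
  "vec_a i \<noteq> vec_b j" "vec_a i \<noteq> vec_c k l" "vec_b i \<noteq> vec_c k l"
  "vec_b j \<noteq> vec_a i" "vec_c k l \<noteq> vec_a i" "vec_c k l \<noteq> vec_b i"
  using vec_le(4-6) by (metis order_refl)+

lemma card_Res_vec_acb:
  assumes "i \<in> {1..6}" "j \<in> {1..6}" "i \<noteq> j"
  shows "card (Res U' {vec_a i, vec_c i j, vec_b j}) = i - 1 + card {k \<in> {1..6}. j < k \<and> k \<noteq> i}"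
proof -
  have "card (vec_a ` {1..<i}) = i - 1"
    using assms by (subst card_image) (auto intro!: inj_onI simp: vec_a_inject)
  moreover have "card (vec_c i ` {k \<in> {1..6}. j < k \<and> k \<noteq> i}) = card {k \<in> {1..6}. j < k \<and> k \<noteq> i}"
    using assms by (intro card_image inj_onI) (auto simp: vec_c_inject doubleton_eq_iff)
  ultimately show ?thesis
    unfolding Res_vec_acb[OF assms] by (subst card_Un_disjoint) (auto simp: vec_neq)
qed

section \<open>Residues of triples indexed by perfect matchings\<close>

lemma perfect_matching_three_iff:
  fixes V :: "'a set"
  assumes "card V = 6"
  shows "perfect_matching V {{i1, j1}, {i2, j2}, {i3, j3}} \<longleftrightarrow>
    distinct [i1, j1, i2, j2, i3, j3] \<and> set [i1, j1, i2, j2, i3, j3] = V"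
proof
  assume "perfect_matching V {{i1, j1}, {i2, j2}, {i3, j3}}"
  \<comment> \<open>Six entries that exhaust a set of six elements cannot repeat.\<close>
  then have "set [i1, j1, i2, j2, i3, j3] = V"
    unfolding perfect_matching_def partition_on_def by auto
  then show "distinct [i1, j1, i2, j2, i3, j3] \<and> set [i1, j1, i2, j2, i3, j3] = V"
    using assms card_distinct[of "[i1, j1, i2, j2, i3, j3]"] by simp
next
  assume "distinct [i1, j1, i2, j2, i3, j3] \<and> set [i1, j1, i2, j2, i3, j3] = V"
  then show "perfect_matching V {{i1, j1}, {i2, j2}, {i3, j3}}"
    unfolding perfect_matching_def partition_on_def by (auto simp: pairwise_def disjnt_def)
qed

text \<open>The index pairs are taken with p < q, so that each \<open>vec_c p q\<close> is listed
  once and the pairs are those counted by the length formula.\<close>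

lemma Res_vec_ccc:
  assumes dist: "distinct [i1, j1, i2, j2, i3, j3]" and set: "set [i1, j1, i2, j2, i3, j3] = {1..6}"
    and \<tau>: "\<tau> i1 = j1" "\<tau> j1 = i1" "\<tau> i2 = j2" "\<tau> j2 = i2" "\<tau> i3 = j3" "\<tau> j3 = i3"
  shows "Res U' {vec_c i1 j1, vec_c i2 j2, vec_c i3 j3} = vec_a ` {1..6} \<union>
    (\<lambda>(p, q). vec_c p q) ` {(p, q) \<in> {1..6} \<times> {1..6}. \<tau> p < q \<and> \<tau> q < p \<and> p < q}"
proof -
  have mem: "x \<in> {1..6} \<longleftrightarrow> x = i1 \<or> x = j1 \<or> x = i2 \<or> x = j2 \<or> x = i3 \<or> x = j3" for x
    using set by (simp only: set_eq_iff) auto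
  have V: "i1 \<in> {1..6}" "j1 \<in> {1..6}" "i2 \<in> {1..6}" "j2 \<in> {1..6}" "i3 \<in> {1..6}" "j3 \<in> {1..6}"
    unfolding mem by simp_all
  have cc: "(\<forall>\<beta>\<in>{vec_c i1 j1, vec_c i2 j2, vec_c i3 j3}. refl_root \<beta> (vec_c p q) \<in> Phi_pos)
      \<longleftrightarrow> \<tau> p < q \<and> \<tau> q < p" if "p \<in> {1..6}" "q \<in> {1..6}" "p \<noteq> q" for p q
  proof -
    have "(\<forall>\<beta>\<in>{vec_c i1 j1, vec_c i2 j2, vec_c i3 j3}. refl_root \<beta> (vec_c p q) \<in> Phi_pos) \<longleftrightarrow>
      (p = i1 \<longrightarrow> j1 < q) \<and> (p = j1 \<longrightarrow> i1 < q) \<and> (q = i1 \<longrightarrow> j1 < p) \<and> (q = j1 \<longrightarrow> i1 < p) \<and>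
      (p = i2 \<longrightarrow> j2 < q) \<and> (p = j2 \<longrightarrow> i2 < q) \<and> (q = i2 \<longrightarrow> j2 < p) \<and> (q = j2 \<longrightarrow> i2 < p) \<and>
      (p = i3 \<longrightarrow> j3 < q) \<and> (p = j3 \<longrightarrow> i3 < q) \<and> (q = i3 \<longrightarrow> j3 < p) \<and> (q = j3 \<longrightarrow> i3 < p)"
      using that V dist by (simp add: refl_root_vec_c_vec_c_Phi_pos del: atLeastAtMost_iff)
    \<comment> \<open>The twelve implications form one family indexed by the label x with partner
      \<tau> x, and only x = p and x = q have an effect.\<close>
    also have "\<dots> \<longleftrightarrow> (\<forall>x\<in>{1..6}. (p = x \<longrightarrow> \<tau> x < q) \<and> (q = x \<longrightarrow> \<tau> x < p))"
      unfolding Ball_def mem imp_disjL all_conj_distrib simp_thms \<tau> by blast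
    also have "\<dots> \<longleftrightarrow> \<tau> p < q \<and> \<tau> q < p"
      using that by blast
    finally show ?thesis .
  qed
  have a: "vec_a h \<in> Res U' {vec_c i1 j1, vec_c i2 j2, vec_c i3 j3}" if "h \<in> {1..6}" for h
    using that V dist by (simp add: Res_def vec_a_U' refl_root_vec_c_Phi_pos del: atLeastAtMost_iff)
  have b: "vec_b h \<notin> Res U' {vec_c i1 j1, vec_c i2 j2, vec_c i3 j3}" if "h \<in> {1..6}" for h
  proof -
    \<comment> \<open>A surviving \<open>vec_b h\<close> would need h in every edge, but the edges
      are disjoint.\<close>
    have "\<not> ((h = i1 \<or> h = j1) \<and> (h = i2 \<or> h = j2))" using dist by auto
    then show ?thesis
      using that V dist by (auto simp: Res_def refl_root_vec_c_Phi_pos simp del: atLeastAtMost_iff)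
  qed
  show ?thesis
  proof (intro equalityI subsetI)
    fix \<gamma> assume \<gamma>: "\<gamma> \<in> Res U' {vec_c i1 j1, vec_c i2 j2, vec_c i3 j3}"
    then have "\<gamma> \<in> U'" by (simp add: Res_def)
    then show "\<gamma> \<in> vec_a ` {1..6} \<union>
        (\<lambda>(p, q). vec_c p q) ` {(p, q) \<in> {1..6} \<times> {1..6}. \<tau> p < q \<and> \<tau> q < p \<and> p < q}"
    proof (cases rule: U'_cases)
      case (c p q)
      then have "\<tau> p < q" "\<tau> q < p"
        using \<gamma> cc[of p q] by (simp_all add: Res_def)
      then have "vec_c p q \<in> (\<lambda>(p, q). vec_c p q) ` {(p, q) \<in> {1..6} \<times> {1..6}. \<tau> p < q \<and> \<tau> q < p \<and> p < q}"
      proof (cases "p < q")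
        case True
        then show ?thesis using \<open>\<tau> p < q\<close> \<open>\<tau> q < p\<close> c by (intro image_eqI[of _ _ "(p, q)"]) auto
      next
        case False
        then show ?thesis using \<open>\<tau> p < q\<close> \<open>\<tau> q < p\<close> c vec_c_commute[of p q]
          by (intro image_eqI[of _ _ "(q, p)"]) auto
      qed
      then show ?thesis using c by blast
    qed (use b \<gamma> in auto)
  next
    fix \<gamma> assume "\<gamma> \<in> vec_a ` {1..6} \<union>
        (\<lambda>(p, q). vec_c p q) ` {(p, q) \<in> {1..6} \<times> {1..6}. \<tau> p < q \<and> \<tau> q < p \<and> p < q}"
    then consider h where "h \<in> {1..6}" "\<gamma> = vec_a h"
      | p q where "p \<in> {1..6}" "q \<in> {1..6}" "p \<noteq> q" "\<tau> p < q" "\<tau> q < p" "\<gamma> = vec_c p q"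
      by auto
    then show "\<gamma> \<in> Res U' {vec_c i1 j1, vec_c i2 j2, vec_c i3 j3}"
    proof cases
      case 1
      then show ?thesis using a by simp
    next
      case 2
      then show ?thesis using cc[of p q] vec_c_U' by (auto simp: Res_def)
    qed
  qed
qed

lemma card_Res_vec_ccc:
  assumes dist: "distinct [i1, j1, i2, j2, i3, j3]" and set: "set [i1, j1, i2, j2, i3, j3] = {1..6}"
    and \<tau>: "\<tau> = Transposition.transpose i1 j1 \<circ> Transposition.transpose i2 j2 \<circ> Transposition.transpose i3 j3"
  shows "2 * card (Res U' {vec_c i1 j1, vec_c i2 j2, vec_c i3 j3}) = coxeter_length 6 \<tau> + 9"
proof -
  have mem: "x \<in> {1..6} \<longleftrightarrow> x = i1 \<or> x = j1 \<or> x = i2 \<or> x = j2 \<or> x = i3 \<or> x = j3" for x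
    using set by (simp only: set_eq_iff) auto
  have vals: "\<tau> i1 = j1" "\<tau> j1 = i1" "\<tau> i2 = j2" "\<tau> j2 = i2" "\<tau> i3 = j3" "\<tau> j3 = i3"
    using dist by (auto simp: \<tau> Transposition.transpose_def)
  have perm: "\<tau> permutes {1..6}"
    unfolding \<tau> by (intro permutes_compose permutes_swap_id) (simp_all only: mem simp_thms)
  have invol: "\<tau> (\<tau> x) = x" for x
  proof (cases "x \<in> {1..6}")
    case True
    then show ?thesis unfolding mem using vals by auto
  next
    case False
    then show ?thesis using permutes_not_in[OF perm] by simp
  qed
  have fpf: "\<tau> x \<noteq> x" if "x \<in> {1..6}" for x
    using that dist vals unfolding mem by auto
  let ?Q = "{(p, q) \<in> {1..6} \<times> {1..6}. \<tau> p < q \<and> \<tau> q < p \<and> p < q}"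
  have "finite ?Q"
    by (rule finite_subset[of _ "{1..6} \<times> {1..6}"]) auto
  have "card (vec_a ` {1..6}) = 6"
    by (subst card_image) (auto intro!: inj_onI simp: vec_a_inject)
  moreover have "card ((\<lambda>(p, q). vec_c p q) ` ?Q) = card ?Q"
    by (intro card_image inj_onI) (auto simp: vec_c_inject doubleton_eq_iff)
  moreover have "vec_a ` {1..6} \<inter> (\<lambda>(p, q). vec_c p q) ` ?Q = {}"
    using vec_neq by auto
  ultimately have "card (Res U' {vec_c i1 j1, vec_c i2 j2, vec_c i3 j3}) = 6 + card ?Q"
    unfolding Res_vec_ccc[OF dist set vals] using \<open>finite ?Q\<close>
    by (subst card_Un_disjoint) auto
  \<comment> \<open>If \<open>?Q\<close> has N elements, the residue set has 6 + N elements and the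
    length is 3 + 2 N.\<close>
  then show ?thesis
    using coxeter_length_fixed_point_free_involution[OF perm invol fpf] by simp
qed

section \<open>Maximal orthogonal subsets of \<open>U'\<close>\<close>

lemma Omega_eqI:
  assumes "T \<noteq> {}" and "n > 0"
    and T: "\<And>R. R \<in> T \<Longrightarrow> R \<subseteq> U \<and> pairwise (\<lambda>\<beta> \<gamma>. B \<beta> \<gamma> = 0) R \<and> card R = n"
    and ext: "\<And>S. S \<subseteq> U \<Longrightarrow> pairwise (\<lambda>\<beta> \<gamma>. B \<beta> \<gamma> = 0) S \<Longrightarrow> \<exists>R\<in>T. S \<subseteq> R"
  shows "Omega U = T"
proof -
  \<comment> \<open>An infinite set would have \<open>card\<close> 0, so positivity of n gives
    finiteness, on which the cardinality comparisons rest.\<close>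
  have fin: "finite R" if "R \<in> T" for R
    using T[OF that] \<open>n > 0\<close> card_ge_0_finite by auto
  have le: "card S \<le> n" if "S \<subseteq> U" "pairwise (\<lambda>\<beta> \<gamma>. B \<beta> \<gamma> = 0) S" for S
    using ext[OF that] T fin card_mono by metis
  show ?thesis
  proof (intro equalityI subsetI)
    fix R assume "R \<in> T"
    then show "R \<in> Omega U"
      using T le unfolding Omega_def is_arg_max_def by (auto simp: not_less)
  next
    fix S assume "S \<in> Omega U"
    then have S: "S \<subseteq> U" "pairwise (\<lambda>\<beta> \<gamma>. B \<beta> \<gamma> = 0) S"
      and max: "\<And>R. R \<subseteq> U \<Longrightarrow> pairwise (\<lambda>\<beta> \<gamma>. B \<beta> \<gamma> = 0) R \<Longrightarrow> card R \<le> card S"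
      unfolding Omega_def is_arg_max_def by (auto simp: not_less)
    have "n \<le> card S"
      using \<open>T \<noteq> {}\<close> T max by blast
    moreover obtain R where "R \<in> T" "S \<subseteq> R"
      using ext[OF S] by blast
    ultimately have "S = R"
      using T fin card_seteq by metis
    then show "S \<in> T" using \<open>R \<in> T\<close> by simp
  qed
qed

lemma ex_perfect_matching:
  assumes "finite V" "even (card V)"
  shows "\<exists>M. perfect_matching V M"
  using assms
proof (induction "card V" arbitrary: V rule: less_induct)
  case less
  show ?case
  proof (cases "V = {}")
    case True
    then show ?thesis
      by (auto simp: perfect_matching_def partition_on_def intro!: exI[of _ "{}"])
  next
    case False
    then have "2 \<le> card V"
      using less.prems by (metis One_nat_def Suc_1 Suc_leI card_gt_0_iff even_Suc le_neq_implies_less odd_one)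
    then obtain e where e: "e \<subseteq> V" "card e = 2"
      using obtain_subset_with_card_n by metis
    then have "card (V - e) = card V - 2"
      using less.prems finite_subset by (metis card_Diff_subset)
    then obtain M where M: "perfect_matching (V - e) M"
      using less \<open>2 \<le> card V\<close> by fastforce
    then have "\<And>c. c \<in> M \<Longrightarrow> c \<inter> e = {}"
      unfolding perfect_matching_def partition_on_def by blast
    moreover have "e \<noteq> {}" using e(2) by auto
    ultimately have "perfect_matching V (insert e M)"
      using M e unfolding perfect_matching_def partition_on_def pairwise_insert disjnt_def
      by (simp add: Int_commute Un_absorb1)
    then show ?thesis ..
  qed
qed

text \<open>Disjoint pairs cover an even number of points, so an even number remains and can be
  matched separately.\<close>

lemma ex_perfect_matching_extending:
  assumes V: "finite V" "even (card V)" and E: "\<And>e. e \<in> E \<Longrightarrow> e \<subseteq> V \<and> card e = 2" "pairwise disjnt E"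
  shows "\<exists>M. perfect_matching V M \<and> E \<subseteq> M"
proof -
  have "finite e" if "e \<in> E" for e
    using E(1)[OF that] V(1) finite_subset by blast
  then have "card (\<Union>E) = sum card E"
    using E(2) by (intro card_Union_disjoint) auto
  then have "even (card (\<Union>E))"
    using E(1) by simp
  moreover have "card (V - \<Union>E) = card V - card (\<Union>E)" "card (\<Union>E) \<le> card V"
    using V(1) E(1) by (auto intro!: card_Diff_subset card_mono finite_subset[of "\<Union>E" V])
  ultimately obtain N where "perfect_matching (V - \<Union>E) N"
    using V ex_perfect_matching[of "V - \<Union>E"] by auto
  then have N: "\<Union>N = V - \<Union>E" "disjoint N" "{} \<notin> N" "\<forall>e\<in>N. card e = 2"
    unfolding perfect_matching_def partition_on_def by simp_all
  have "{} \<notin> E" using E(1) by force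
  moreover have "disjoint (E \<union> N)"
    using E(2) N(1,2) by (intro disjoint_union) auto
  moreover have "\<Union>(E \<union> N) = V"
    using N(1) E(1) by auto
  ultimately have "perfect_matching V (E \<union> N)"
    using E(1) N unfolding perfect_matching_def partition_on_def by auto
  then show ?thesis by blast
qed

lemma orthogonal_subset_vec_c:
  assumes orth: "pairwise (\<lambda>\<beta> \<gamma>. B \<beta> \<gamma> = 0) S"
    and S: "S \<subseteq> {vec_c p q | p q. p \<in> {1..6} \<and> q \<in> {1..6} \<and> p \<noteq> q}"
  shows "\<exists>i1 j1 i2 j2 i3 j3. perfect_matching {1..6} {{i1, j1}, {i2, j2}, {i3, j3}} \<and>
    S \<subseteq> {vec_c i1 j1, vec_c i2 j2, vec_c i3 j3}"
proof -
  define E where "E = {{p, q} | p q. p \<in> {1..6} \<and> q \<in> {1..6} \<and> p \<noteq> q \<and> vec_c p q \<in> S}"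
  have "pairwise disjnt E"
  proof (rule pairwiseI)
    fix e e' assume "e \<in> E" "e' \<in> E" "e \<noteq> e'"
    then obtain p q p' q' where e: "e = {p, q}" "e' = {p', q'}" "p \<noteq> q" "p' \<noteq> q'"
        "vec_c p q \<in> S" "vec_c p' q' \<in> S" "p \<in> {1..6}" "q \<in> {1..6}" "p' \<in> {1..6}" "q' \<in> {1..6}"
      unfolding E_def by blast
    then have "vec_c p q \<noteq> vec_c p' q'"
      using \<open>e \<noteq> e'\<close> vec_c_inject by metis
    then have "B (vec_c p q) (vec_c p' q') = 0"
      using orth e(5,6) unfolding pairwise_def by blast
    then show "disjnt e e'"
      using e by (auto simp: B_cc disjnt_def of_bool_def split: if_splits)
  qed
  moreover have "e \<subseteq> {1..6} \<and> card e = 2" if "e \<in> E" for e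
    using that by (auto simp: E_def)
  ultimately obtain M where M: "perfect_matching {1..6} M" "E \<subseteq> M"
    using ex_perfect_matching_extending[of "{1..6}" E] by auto
  \<comment> \<open>Edges of size 2 that partition six labels are three in number.\<close>
  have "card (\<Union>M) = sum card M"
    using M(1) unfolding perfect_matching_def partition_on_def
    by (intro card_Union_disjoint) (auto intro: card_ge_0_finite)
  also have "\<dots> = 2 * card M"
    using M(1) by (simp add: perfect_matching_def)
  finally have "card M = 3"
    using M(1) by (simp add: perfect_matching_def partition_on_def)
  then obtain e1 e2 e3 where M_eq: "M = {e1, e2, e3}"
    by (auto simp: card_3_iff)
  moreover have "\<exists>i j. e = {i, j}" if "e \<in> M" for e
    using M(1) that unfolding perfect_matching_def card_2_iff by blast
  ultimately obtain i1 j1 i2 j2 i3 j3 where ij: "M = {{i1, j1}, {i2, j2}, {i3, j3}}"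
    by (metis insertCI)
  have "S \<subseteq> {vec_c i1 j1, vec_c i2 j2, vec_c i3 j3}"
  proof
    fix \<gamma> assume "\<gamma> \<in> S"
    moreover from this obtain p q where pq: "\<gamma> = vec_c p q" "p \<in> {1..6}" "q \<in> {1..6}" "p \<noteq> q"
      using subsetD[OF S] by blast
    ultimately have "{p, q} \<in> E"
      unfolding E_def by (intro CollectI exI[of _ p] exI[of _ q]) simp
    then have "{p, q} \<in> {{i1, j1}, {i2, j2}, {i3, j3}}"
      using M(2) ij by blast
    then show "\<gamma> \<in> {vec_c i1 j1, vec_c i2 j2, vec_c i3 j3}"
      using pq(1) vec_c_eqI[of p q i1 j1] vec_c_eqI[of p q i2 j2] vec_c_eqI[of p q i3 j3] by blast
  qed
  then show ?thesis
    using M(1) ij by blast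
qed

text \<open>The disjunction in the third assumption is what pairwise orthogonality yields for a
  member that may be the given root itself.\<close>

lemma vec_a_orthogonal_cases:
  assumes "i \<in> {1..6}" "\<gamma> \<in> U'" "\<gamma> = vec_a i \<or> B (vec_a i) \<gamma> = 0"
  obtains "\<gamma> = vec_a i" | j where "j \<in> {1..6}" "i \<noteq> j" "\<gamma> = vec_c i j"
    | j where "j \<in> {1..6}" "i \<noteq> j" "\<gamma> = vec_b j"
  using assms(2)
proof (cases rule: U'_cases)
  case (a h)
  then show ?thesis using assms that by (auto simp: B_aa of_bool_def split: if_splits)
next
  case (b h)
  then show ?thesis using assms that vec_neq by (auto simp: B_ab)
next
  case (c k l)
  then have "i = k \<or> i = l" using assms by (auto simp: B_ac vec_neq)
  then show ?thesis using c that vec_c_commute by metis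
qed

lemma vec_b_orthogonal_cases:
  assumes "j \<in> {1..6}" "\<gamma> \<in> U'" "\<gamma> = vec_b j \<or> B (vec_b j) \<gamma> = 0"
  obtains "\<gamma> = vec_b j" | i where "i \<in> {1..6}" "i \<noteq> j" "\<gamma> = vec_c i j"
    | i where "i \<in> {1..6}" "i \<noteq> j" "\<gamma> = vec_a i"
  using assms(2)
proof (cases rule: U'_cases)
  case (a h)
  then show ?thesis using assms that vec_neq by (auto simp: B_ab B_commute[of "vec_b _" "vec_a _"])
next
  case (b h)
  then show ?thesis using assms that by (auto simp: B_bb of_bool_def split: if_splits)
next
  case (c k l)
  then have "j = k \<or> j = l" using assms by (auto simp: B_bc vec_neq)
  then show ?thesis using c that vec_c_commute by metis
qed

text \<open>The cases depend on whether \<open>S\<close> meets the \<open>vec_a\<close> and the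
  \<open>vec_b\<close> family. One such root forces every \<open>vec_c\<close> in \<open>S\<close>
  to contain its label, and two distinct roots \<open>vec_c\<close> with a common label are not
  orthogonal.\<close>

lemma orthogonal_subset_U':
  assumes U: "S \<subseteq> U'" and orth: "pairwise (\<lambda>\<beta> \<gamma>. B \<beta> \<gamma> = 0) S"
  shows "(\<exists>i j. i \<in> {1..6} \<and> j \<in> {1..6} \<and> i \<noteq> j \<and> S \<subseteq> {vec_a i, vec_c i j, vec_b j}) \<or>
    (\<exists>i1 j1 i2 j2 i3 j3. perfect_matching {1..6} {{i1, j1}, {i2, j2}, {i3, j3}} \<and>
      S \<subseteq> {vec_c i1 j1, vec_c i2 j2, vec_c i3 j3})"
proof -
  have o: "\<gamma> = \<beta> \<or> B \<beta> \<gamma> = 0" if "\<beta> \<in> S" "\<gamma> \<in> S" for \<beta> \<gamma>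
    using orth that unfolding pairwise_def by metis
  have cc: "j = k" if "vec_c i j \<in> S" "vec_c i k \<in> S" "i \<in> {1..6}" "j \<in> {1..6}" "k \<in> {1..6}" "i \<noteq> j" "i \<noteq> k"
    for i j k
    using o[OF that(1,2)] that(3-) by (auto simp: B_cc vec_c_inject doubleton_eq_iff of_bool_def split: if_splits)
  consider (ab) i j where "i \<in> {1..6}" "vec_a i \<in> S" "j \<in> {1..6}" "vec_b j \<in> S"
    | (a) i where "i \<in> {1..6}" "vec_a i \<in> S" "\<And>j. j \<in> {1..6} \<Longrightarrow> vec_b j \<notin> S"
    | (b) j where "j \<in> {1..6}" "vec_b j \<in> S" "\<And>i. i \<in> {1..6} \<Longrightarrow> vec_a i \<notin> S"
    | (c) "\<And>i. i \<in> {1..6} \<Longrightarrow> vec_a i \<notin> S" "\<And>i. i \<in> {1..6} \<Longrightarrow> vec_b i \<notin> S"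
    by blast
  then show ?thesis
  proof cases
    case ab
    then have "i \<noteq> j"
      using o[of "vec_a i" "vec_b j"] B_ab[of i j] by (auto simp: vec_neq)
    have "S \<subseteq> {vec_a i, vec_c i j, vec_b j}"
    proof
      fix \<gamma> assume "\<gamma> \<in> S"
      then have "\<gamma> \<in> U'" using U by blast
      from ab(1) this o[OF ab(2) \<open>\<gamma> \<in> S\<close>]
      show "\<gamma> \<in> {vec_a i, vec_c i j, vec_b j}"
      proof (cases rule: vec_a_orthogonal_cases)
        case (2 k)
        then have "j = k"
          using o[OF ab(4) \<open>\<gamma> \<in> S\<close>] ab vec_neq(3,6)[of j i k] B_bc[of j i k] \<open>i \<noteq> j\<close> by (auto simp: of_bool_def split: if_splits)
        then show ?thesis using 2 by simp
      next
        case (3 k)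
        then have "j = k"
          using o[OF ab(4) \<open>\<gamma> \<in> S\<close>] ab(3) B_bb[of j k] B_bb[of j j] by (auto simp: of_bool_def split: if_splits)
        then show ?thesis using 3 by simp
      qed simp
    qed
    then show ?thesis using ab \<open>i \<noteq> j\<close> by blast
  next
    case a
    have S_cases: "\<gamma> = vec_a i \<or> (\<exists>j\<in>{1..6}. i \<noteq> j \<and> \<gamma> = vec_c i j)" if "\<gamma> \<in> S" for \<gamma>
      using vec_a_orthogonal_cases[OF a(1) _ o[OF a(2) that]] that U a(3) by (metis subsetD)
    show ?thesis
    proof (cases "\<exists>j\<in>{1..6}. i \<noteq> j \<and> vec_c i j \<in> S")
      case True
      then obtain j where "j \<in> {1..6}" "i \<noteq> j" "vec_c i j \<in> S" by blast
      then have "S \<subseteq> {vec_a i, vec_c i j, vec_b j}"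
        using S_cases cc[of i j] a(1) by blast
      then show ?thesis using a(1) \<open>j \<in> {1..6}\<close> \<open>i \<noteq> j\<close> by blast
    next
      case False
      \<comment> \<open>Here \<open>S\<close> has no member besides \<open>vec_a i\<close>, so any
        other label completes a triple.\<close>
      obtain j :: nat where "j \<in> {1..6}" "i \<noteq> j"
        using that[of 1] that[of 2] by force
      moreover have "S \<subseteq> {vec_a i, vec_c i j, vec_b j}"
        using False S_cases by blast
      ultimately show ?thesis using a(1) by blast
    qed
  next
    case b
    have S_cases: "\<gamma> = vec_b j \<or> (\<exists>i\<in>{1..6}. i \<noteq> j \<and> \<gamma> = vec_c i j)" if "\<gamma> \<in> S" for \<gamma>
      using vec_b_orthogonal_cases[OF b(1) _ o[OF b(2) that]] that U b(3) by (metis subsetD)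
    show ?thesis
    proof (cases "\<exists>i\<in>{1..6}. i \<noteq> j \<and> vec_c i j \<in> S")
      case True
      then obtain i where "i \<in> {1..6}" "i \<noteq> j" "vec_c i j \<in> S" by blast
      then have "S \<subseteq> {vec_a i, vec_c i j, vec_b j}"
        using S_cases cc[of j i] b(1) vec_c_commute[of j] by (metis (no_types, lifting) insertCI subsetI)
      then show ?thesis using b(1) \<open>i \<in> {1..6}\<close> \<open>i \<noteq> j\<close> by blast
    next
      case False
      obtain i :: nat where "i \<in> {1..6}" "i \<noteq> j"
        using that[of 1] that[of 2] by force
      moreover have "S \<subseteq> {vec_a i, vec_c i j, vec_b j}"
        using False S_cases by blast
      ultimately show ?thesis using b(1) by blast
    qed
  next
    case c
    then have "S \<subseteq> {vec_c p q | p q. p \<in> {1..6} \<and> q \<in> {1..6} \<and> p \<noteq> q}"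
      using U U'_cases by (smt (verit, best) mem_Collect_eq subset_iff)
    then show ?thesis using orthogonal_subset_vec_c[OF orth] by blast
  qed
qed

section \<open>Translation to the labelled roots\<close>

lemma perfect_matching_1_to_6:
  assumes "perfect_matching {1..6::nat} {{i1, j1}, {i2, j2}, {i3, j3}}"
  shows "distinct [i1, j1, i2, j2, i3, j3]" "set [i1, j1, i2, j2, i3, j3] = {1..6}"
    "i1 \<in> {1..6}" "j1 \<in> {1..6}" "i2 \<in> {1..6}" "j2 \<in> {1..6}" "i3 \<in> {1..6}" "j3 \<in> {1..6}"
proof -
  show "distinct [i1, j1, i2, j2, i3, j3]" and set: "set [i1, j1, i2, j2, i3, j3] = {1..6}"
    using assms perfect_matching_three_iff[of "{1..6::nat}" i1 j1 i2 j2 i3 j3] by simp_all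
  show "i1 \<in> {1..6}" "j1 \<in> {1..6}" "i2 \<in> {1..6}" "j2 \<in> {1..6}" "i3 \<in> {1..6}" "j3 \<in> {1..6}"
    unfolding set[symmetric] by simp_all
qed

lemma root_acb_eq:
  assumes "i \<in> {1..6}" "j \<in> {1..6}" "i \<noteq> j"
  shows "{root_a i, root_c i j, root_b j} = {vec_a i, vec_c i j, vec_b j}"
  using assms by (simp add: root_a_eq root_b_eq root_c_eq del: atLeastAtMost_iff)

lemma root_ccc_eq:
  assumes "perfect_matching {1..6} {{i1, j1}, {i2, j2}, {i3, j3}}"
  shows "{root_c i1 j1, root_c i2 j2, root_c i3 j3} = {vec_c i1 j1, vec_c i2 j2, vec_c i3 j3}"
  using perfect_matching_1_to_6[OF assms] by (simp add: root_c_eq del: atLeastAtMost_iff)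

theorem theorem5p17:
  shows "Omega U' =
           {{root_a i, root_c i j, root_b j} | i j. i \<in> {1..6} \<and> j \<in> {1..6} \<and> i \<noteq> j} \<union>
           {{root_c i1 j1, root_c i2 j2, root_c i3 j3} | i1 j1 i2 j2 i3 j3.
              perfect_matching {1..6} {{i1,j1}, {i2,j2}, {i3,j3}}} \<and>
         (\<forall>i j :: nat. 1 \<le> i \<and> i < j \<and> j \<le> 6 \<longrightarrow>
           int (level U' {root_a i, root_c i j, root_b j}) = 5 + int i - int j \<and>
           Res U' {root_a i, root_c i j, root_b j} =
             {root_a h | h. 1 \<le> h \<and> h < i} \<union> {root_c i k | k. j < k \<and> k \<le> 6}) \<and>
         (\<forall>i j :: nat. 1 \<le> j \<and> j < i \<and> i \<le> 6 \<longrightarrow>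
           int (level U' {root_a i, root_c i j, root_b j}) = 4 + int i - int j \<and>
           Res U' {root_a i, root_c i j, root_b j} =
             {root_a h | h. 1 \<le> h \<and> h < i} \<union>
             {root_c k i | k. j < k \<and> k \<le> 6 \<and> k \<noteq> i}) \<and>
         (\<forall>(i1::nat) j1 i2 j2 i3 j3 \<tau>.
           perfect_matching {1..6} {{i1,j1}, {i2,j2}, {i3,j3}} \<and>
           \<tau> = Transposition.transpose i1 j1 \<circ> Transposition.transpose i2 j2
                 \<circ> Transposition.transpose i3 j3 \<longrightarrow>
           real (level U' {root_c i1 j1, root_c i2 j2, root_c i3 j3})
             = (real (coxeter_length 6 \<tau>) + 9) / 2 \<and>
           Res U' {root_c i1 j1, root_c i2 j2, root_c i3 j3} =
             {root_a i | i. 1 \<le> i \<and> i \<le> 6} \<union>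
             {root_c p q | p q. p \<in> {1..6} \<and> q \<in> {1..6} \<and> p \<noteq> q \<and> \<tau> p < q \<and> \<tau> q < p})"
proof (intro conjI allI impI)
  let ?acb = "{{root_a i, root_c i j, root_b j} | i j. i \<in> {1..6} \<and> j \<in> {1..6} \<and> i \<noteq> j}"
  let ?ccc = "{{root_c i1 j1, root_c i2 j2, root_c i3 j3} | i1 j1 i2 j2 i3 j3.
      perfect_matching {1..6} {{i1,j1}, {i2,j2}, {i3,j3}}}"
  show "Omega U' = ?acb \<union> ?ccc"
  proof (rule Omega_eqI[where n = 3])
    have "{root_a 1, root_c 1 2, root_b 2} \<in> ?acb"
      by (intro CollectI exI[of _ 1] exI[of _ 2]) simp
    then show "?acb \<union> ?ccc \<noteq> {}" by blast
    show "(0::nat) < 3" by simp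
  next
    fix R assume "R \<in> ?acb \<union> ?ccc"
    then consider (1) i j where "R = {root_a i, root_c i j, root_b j}" "i \<in> {1..6}" "j \<in> {1..6}" "i \<noteq> j"
      | (2) i1 j1 i2 j2 i3 j3 where "R = {root_c i1 j1, root_c i2 j2, root_c i3 j3}"
        "perfect_matching {1..6} {{i1,j1}, {i2,j2}, {i3,j3}}"
      by blast
    then show "R \<subseteq> U' \<and> pairwise (\<lambda>\<beta> \<gamma>. B \<beta> \<gamma> = 0) R \<and> card R = 3"
    proof cases
      case 1
      then have R: "R = {vec_a i, vec_c i j, vec_b j}" using root_acb_eq by simp
      have "card R = 3"
        unfolding R by (simp add: vec_neq)
      moreover have "pairwise (\<lambda>\<beta> \<gamma>. B \<beta> \<gamma> = 0) R"
        unfolding R pairwise_insert using 1 B_ab[of i j] B_ac[of i i j] B_bc[of j i j]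
        by (auto simp: B_commute[of "vec_b j" "vec_a i"] B_commute[of "vec_c i j" "vec_a i"]
              B_commute[of "vec_c i j" "vec_b j"] simp del: atLeastAtMost_iff)
      ultimately show ?thesis
        unfolding R using 1 by (simp add: vec_a_U' vec_b_U' vec_c_U')
    next
      case 2
      note R = 2(1)[unfolded root_ccc_eq[OF 2(2)]] and ij = perfect_matching_1_to_6[OF 2(2)]
      have "card R = 3"
        unfolding R using ij by (simp add: vec_c_inject doubleton_eq_iff del: atLeastAtMost_iff)
      have "B (vec_c i1 j1) (vec_c i2 j2) = 0" "B (vec_c i1 j1) (vec_c i3 j3) = 0"
        "B (vec_c i2 j2) (vec_c i1 j1) = 0" "B (vec_c i2 j2) (vec_c i3 j3) = 0"
        "B (vec_c i3 j3) (vec_c i1 j1) = 0" "B (vec_c i3 j3) (vec_c i2 j2) = 0"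
        using ij by (auto simp add: B_cc simp del: atLeastAtMost_iff)
      then have "pairwise (\<lambda>\<beta> \<gamma>. B \<beta> \<gamma> = 0) R"
        unfolding R pairwise_def by blast
      moreover note \<open>card R = 3\<close>
      ultimately show ?thesis
        unfolding R using ij by (simp add: vec_c_U' del: atLeastAtMost_iff)
    qed
  next
    fix S assume "S \<subseteq> U'" "pairwise (\<lambda>\<beta> \<gamma>. B \<beta> \<gamma> = 0) S"
    then show "\<exists>R\<in>?acb \<union> ?ccc. S \<subseteq> R"
    proof (rule orthogonal_subset_U'[THEN disjE])
      assume "\<exists>i j. i \<in> {1..6} \<and> j \<in> {1..6} \<and> i \<noteq> j \<and> S \<subseteq> {vec_a i, vec_c i j, vec_b j}"
      then obtain i j where ij: "i \<in> {1..6}" "j \<in> {1..6}" "i \<noteq> j" "S \<subseteq> {vec_a i, vec_c i j, vec_b j}"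
        by blast
      then have "{root_a i, root_c i j, root_b j} \<in> ?acb \<union> ?ccc" by blast
      then show ?thesis
        using ij(4) root_acb_eq[OF ij(1-3)] by (intro bexI) simp_all
    next
      assume "\<exists>i1 j1 i2 j2 i3 j3. perfect_matching {1..6} {{i1, j1}, {i2, j2}, {i3, j3}} \<and>
        S \<subseteq> {vec_c i1 j1, vec_c i2 j2, vec_c i3 j3}"
      then obtain i1 j1 i2 j2 i3 j3 where M: "perfect_matching {1..6} {{i1, j1}, {i2, j2}, {i3, j3}}"
        "S \<subseteq> {vec_c i1 j1, vec_c i2 j2, vec_c i3 j3}"
        by blast
      then have "{root_c i1 j1, root_c i2 j2, root_c i3 j3} \<in> ?acb \<union> ?ccc" by blast
      then show ?thesis
        using M(2) root_ccc_eq[OF M(1)] by (intro bexI) simp_all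
    qed
  qed

  fix i j :: nat
  {
    assume "1 \<le> i \<and> i < j \<and> j \<le> 6"
    then have ij: "i \<in> {1..6}" "j \<in> {1..6}" "i \<noteq> j" and "i < j" by auto
    have "{k \<in> {1..6}. j < k \<and> k \<noteq> i} = {j<..6}"
      using ij \<open>i < j\<close> by auto
    then show "int (level U' {root_a i, root_c i j, root_b j}) = 5 + int i - int j"
      using ij unfolding level_def root_acb_eq[OF ij] card_Res_vec_acb[OF ij] by auto
    show "Res U' {root_a i, root_c i j, root_b j} =
        {root_a h | h. 1 \<le> h \<and> h < i} \<union> {root_c i k | k. j < k \<and> k \<le> 6}"
      using ij \<open>i < j\<close> unfolding root_acb_eq[OF ij] Res_vec_acb[OF ij] setcompr_eq_image
      by (intro arg_cong2[of _ _ _ _ "(\<union>)"] image_cong) (auto simp: root_a_eq root_c_eq)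
  }
  {
    assume "1 \<le> j \<and> j < i \<and> i \<le> 6"
    then have ij: "i \<in> {1..6}" "j \<in> {1..6}" "i \<noteq> j" and "j < i" by auto
    \<comment> \<open>Now i itself lies above j and is left out, which lowers the level formula by 1
      compared with the case i < j.\<close>
    have "{k \<in> {1..6}. j < k \<and> k \<noteq> i} = {j<..6} - {i}"
      using ij by auto
    then have "card {k \<in> {1..6}. j < k \<and> k \<noteq> i} = 5 - j"
      using ij \<open>j < i\<close> by simp
    then show "int (level U' {root_a i, root_c i j, root_b j}) = 4 + int i - int j"
      using ij \<open>j < i\<close> unfolding level_def root_acb_eq[OF ij] card_Res_vec_acb[OF ij] by auto
    show "Res U' {root_a i, root_c i j, root_b j} =
        {root_a h | h. 1 \<le> h \<and> h < i} \<union> {root_c k i | k. j < k \<and> k \<le> 6 \<and> k \<noteq> i}"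
      using ij \<open>j < i\<close> unfolding root_acb_eq[OF ij] Res_vec_acb[OF ij] setcompr_eq_image
      by (intro arg_cong2[of _ _ _ _ "(\<union>)"] image_cong)
        (auto simp: root_a_eq root_c_eq vec_c_commute[of _ i])
  }
next
  fix i1 j1 i2 j2 i3 j3 :: nat and \<tau>
  assume "perfect_matching {1..6} {{i1,j1}, {i2,j2}, {i3,j3}} \<and>
    \<tau> = Transposition.transpose i1 j1 \<circ> Transposition.transpose i2 j2 \<circ> Transposition.transpose i3 j3"
  then have M: "perfect_matching {1..6} {{i1,j1}, {i2,j2}, {i3,j3}}" and \<tau>:
    "\<tau> = Transposition.transpose i1 j1 \<circ> Transposition.transpose i2 j2 \<circ> Transposition.transpose i3 j3"
    by simp_all
  note ij = perfect_matching_1_to_6[OF M]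
  show "real (level U' {root_c i1 j1, root_c i2 j2, root_c i3 j3})
      = (real (coxeter_length 6 \<tau>) + 9) / 2"
    using card_Res_vec_ccc[OF ij(1,2) \<tau>] unfolding level_def root_ccc_eq[OF M] by simp
  have vals: "\<tau> i1 = j1" "\<tau> j1 = i1" "\<tau> i2 = j2" "\<tau> j2 = i2" "\<tau> i3 = j3" "\<tau> j3 = i3"
    using ij(1) by (auto simp: \<tau> Transposition.transpose_def)
  have "vec_a ` {1..6} = {root_a i | i. 1 \<le> i \<and> i \<le> 6}"
    unfolding setcompr_eq_image by (intro image_cong) (auto simp: root_a_eq)
  \<comment> \<open>The right-hand side lists each root for both orders of its labels; the
    conditions on p and q are symmetric, so the order p < q suffices.\<close>
  moreover have "(\<lambda>(p, q). vec_c p q) ` {(p, q) \<in> {1..6} \<times> {1..6}. \<tau> p < q \<and> \<tau> q < p \<and> p < q}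
      = {root_c p q | p q. p \<in> {1..6} \<and> q \<in> {1..6} \<and> p \<noteq> q \<and> \<tau> p < q \<and> \<tau> q < p}" (is "?L = ?R")
  proof (intro equalityI subsetI)
    fix \<gamma> assume "\<gamma> \<in> ?L"
    then obtain p q where pq: "p \<in> {1..6}" "q \<in> {1..6}" "p < q" "\<tau> p < q" "\<tau> q < p" "\<gamma> = vec_c p q"
      by auto
    then have "\<gamma> = root_c p q" "p \<noteq> q" by (simp_all add: root_c_eq)
    then show "\<gamma> \<in> ?R" using pq by blast
  next
    fix \<gamma> assume "\<gamma> \<in> ?R"
    then obtain p q where pq: "p \<in> {1..6}" "q \<in> {1..6}" "p \<noteq> q" "\<tau> p < q" "\<tau> q < p" "\<gamma> = root_c p q"
      by blast
    then have "\<gamma> = vec_c p q" "\<gamma> = vec_c q p" by (simp_all add: root_c_eq vec_c_commute[of q])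
    then show "\<gamma> \<in> ?L"
      using pq(1-5) image_eqI[of \<gamma> "\<lambda>(p, q). vec_c p q" "(p, q)"]
        image_eqI[of \<gamma> "\<lambda>(p, q). vec_c p q" "(q, p)"]
      by (cases "p < q") auto
  qed
  ultimately show "Res U' {root_c i1 j1, root_c i2 j2, root_c i3 j3} =
      {root_a i | i. 1 \<le> i \<and> i \<le> 6} \<union>
      {root_c p q | p q. p \<in> {1..6} \<and> q \<in> {1..6} \<and> p \<noteq> q \<and> \<tau> p < q \<and> \<tau> q < p}"
    unfolding root_ccc_eq[OF M] Res_vec_ccc[OF ij(1,2) vals] by (simp only:)
qed

end
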